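(* Let $n \geq 2$, let $L \subset \mathbb{R}^n$ be a smooth convex body such that $0 \in \operatorname{int} L$ and $L \subset -nL$, and let $K \subset \mathbb{R}^n$ be an arbitrary convex body. There exists $\varepsilon_0(L) > 0$ such that if $0 \leq \varepsilon \leq \varepsilon_0(L)$ and $d_G(K,L) \geq (1-\varepsilon)n$, then $$d(K, S_n) \leq 1 + 40 n^3 r,$$ where $0 \leq r = r(\varepsilon) < 1$ and $r$ and $\varepsilon_0(L)$ may be taken as follows: (1) For a general smooth convex body $L$ with $0 \in \operatorname{int} L$ and $L \subset -nL$, $r$ is the infimum of the numbers $r$ satisfying $r \cdot \delta_{L^{\circ}}\left(\frac{r}{4n^3}\right) \geq 4n^2 \varepsilon$, and one can take $\varepsilon_0(L) = \frac{\delta_{L^{\circ}}\left(\frac{1}{80n^6}\right)}{80 n^5}$. (2) If $L$ is additionally centrally symmetric with respect to the origin, $r$ is the infimum of the numbers $r$ satisfying $r \cdot \delta_{L^{\circ}}\left(\frac{r}{2n^2}\right) \geq 4n\varepsilon$, and one can take $\varepsilon_0(L) = \frac{\delta_{L^{\circ}}\left(\frac{1}{40n^5}\right)}{80n^4}$. (3) If $L$ is an ellipsoid, $r = (16\varepsilon)^{\frac{1}{3}}$, and one can take $\varepsilon_0(L) = \frac{1}{128000 n^9}$.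
   Context: A convex body in $\mathbb{R}^n$ is a compact convex set with non-empty interior. It is smooth if it has a unique supporting hyperplane at each boundary point. $S_n$ denotes the regular simplex in $\mathbb{R}^n$. For convex bodies $K, L \subset \mathbb{R}^n$, the Banach-Mazur distance is $d(K,L) = \inf\{ r > 0 : K+u \subset T(L+v) \subset r(K+u)\}$ and the Grünbaum distance is $d_G(K,L) = \inf\{ |r| : r \in \mathbb{R},\ K+u \subset T(L+v) \subset r(K+u)\}$, where both infima are taken over all invertible linear operators $T:\mathbb{R}^n \to \mathbb{R}^n$ and all $u,v \in \mathbb{R}^n$. If $0 \in \operatorname{int} K$, the polar body is $K^{\circ} = \{x \in \mathbb{R}^n : \langle x,y\rangle \leq 1 \text{ for every } y \in K\}$ and the gauge function is $\|x\|_K = \inf\{t > 0 : x \in tK\}$ (not necessarily symmetric). The modulus of convexity of a (not necessarily symmetric) convex body $K$ with $0 \in \operatorname{int} K$ is the function $\delta_K : [0,1] \to [0,\infty)$, $$\delta_K(t) = \inf\left\{ 1 - \left\| \frac{x+y}{2}\right\|_K : x,y \in K,\ \|x-y\|_K \geq t \right\}.$$ The numbers $r$ over which the infima in (1) and (2) are taken are nonnegative reals for which the argument of $\delta_{L^\circ}$ lies in its domain $[0,1]$. *)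

theory Defs
  imports "HOL-Analysis.Analysis"
begin

definition convex_body :: "'a::euclidean_space set \<Rightarrow> bool" where
  "convex_body K \<longleftrightarrow> compact K \<and> convex K \<and> interior K \<noteq> {}"

text \<open>Hyperplanes are treated as point sets, so that uniqueness of a supporting hyperplane
  is not affected by rescaling its normal vector.\<close>

definition supporting_hyperplane :: "'a::euclidean_space set \<Rightarrow> 'a \<Rightarrow> 'a set \<Rightarrow> bool" where
  "supporting_hyperplane K x H \<longleftrightarrow>
     (\<exists>a b. a \<noteq> 0 \<and> H = {y. a \<bullet> y = b} \<and> x \<in> H \<and> K \<subseteq> {y. a \<bullet> y \<le> b})"

definition smooth_body :: "'a::euclidean_space set \<Rightarrow> bool" where
  "smooth_body K \<longleftrightarrow> (\<forall>x\<in>frontier K. \<exists>!H. supporting_hyperplane K x H)"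

definition centrally_symmetric :: "'a::euclidean_space set \<Rightarrow> bool" where
  "centrally_symmetric K \<longleftrightarrow> uminus ` K = K"

text \<open>Ellipsoids may have any centre.\<close>

definition ellipsoid :: "'a::euclidean_space set \<Rightarrow> bool" where
  "ellipsoid E \<longleftrightarrow> (\<exists>(T :: 'a \<Rightarrow> 'a) c. linear T \<and> bij T \<and> E = (\<lambda>x. T x + c) ` cball 0 1)"

definition regular_simplex :: "'a::euclidean_space set \<Rightarrow> bool" where
  "regular_simplex S \<longleftrightarrow>
     (\<exists>C s. finite C \<and> card C = DIM('a) + 1 \<and> \<not> affine_dependent C \<and>
        s > 0 \<and> (\<forall>x\<in>C. \<forall>y\<in>C. x \<noteq> y \<longrightarrow> dist x y = s) \<and> S = convex hull C)"

definition banach_mazur_dist :: "'a::euclidean_space set \<Rightarrow> 'a set \<Rightarrow> real" where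
  "banach_mazur_dist K L =
     Inf {r. r > 0 \<and> (\<exists>T u v. linear T \<and> bij T \<and>
            (\<lambda>x. x + u) ` K \<subseteq> T ` (\<lambda>x. x + v) ` L \<and>
            T ` (\<lambda>x. x + v) ` L \<subseteq> (*\<^sub>R) r ` (\<lambda>x. x + u) ` K)}"

text \<open>Here the ratio is allowed to be negative.\<close>

definition grunbaum_dist :: "'a::euclidean_space set \<Rightarrow> 'a set \<Rightarrow> real" where
  "grunbaum_dist K L =
     Inf {\<bar>r\<bar> | r. \<exists>T u v. linear T \<and> bij T \<and>
            (\<lambda>x. x + u) ` K \<subseteq> T ` (\<lambda>x. x + v) ` L \<and>
            T ` (\<lambda>x. x + v) ` L \<subseteq> (*\<^sub>R) r ` (\<lambda>x. x + u) ` K}"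

definition polar_body :: "'a::euclidean_space set \<Rightarrow> 'a set" where
  "polar_body K = {x. \<forall>y\<in>K. x \<bullet> y \<le> 1}"

text \<open>The Minkowski functional of \<open>K\<close>; unrelated to the library's \<^const>\<open>gauge\<close>, which is
  the Henstock--Kurzweil notion.\<close>

definition gauge_fun :: "'a::euclidean_space set \<Rightarrow> 'a \<Rightarrow> real" where
  "gauge_fun K x = Inf {t. t > 0 \<and> x \<in> (*\<^sub>R) t ` K}"

text \<open>Only meaningful for \<open>t \<in> {0..1}\<close> and \<open>0 \<in> interior K\<close>; for large \<open>t\<close> the infimum
  would range over the empty set.\<close>

definition modulus_of_convexity :: "'a::euclidean_space set \<Rightarrow> real \<Rightarrow> real" where
  "modulus_of_convexity K t =
     Inf {1 - gauge_fun K ((1/2) *\<^sub>R (x + y)) | x y.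
            x \<in> K \<and> y \<in> K \<and> gauge_fun K (x - y) \<ge> t}"

text \<open>Regular simplices exist in every dimension, so quantifying over all of them is not vacuous:
  the standard basis vectors, together with a suitable multiple of their sum, are equidistant.\<close>

lemma regular_simplex_exists: "\<exists>S :: 'a::euclidean_space set. regular_simplex S"
proof -
  define n where "n = real DIM('a)"
  have n: "n \<ge> 1"
    using DIM_positive[where 'a='a] unfolding n_def by linarith
  define c where "c = (1 - sqrt (1 + n)) / n"
  have c: "n * c\<^sup>2 - 2 * c = 1"
  proof -
    have "n * c = 1 - sqrt (1 + n)" using n by (simp add: c_def)
    moreover have "(sqrt (1 + n))\<^sup>2 = 1 + n" using n by simp
    ultimately have "(n * c - 1)\<^sup>2 = 1 + n" by simp
    hence "n * (n * c\<^sup>2 - 2 * c) = n * 1" by (simp add: power2_eq_square algebra_simps)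
    thus ?thesis using n by (simp only: mult_cancel_left) auto
  qed
  have nc: "n * c < 1" using n by (simp add: c_def)
  define p :: 'a where "p = c *\<^sub>R (\<Sum>b\<in>Basis. b)"
  have pb: "p \<bullet> b = c" if "b \<in> Basis" for b
    using that by (simp add: p_def inner_sum_left inner_Basis if_distrib cong: if_cong)
  have "p \<bullet> p = (\<Sum>b\<in>(Basis::'a set). c * c)"
    by (subst euclidean_inner) (simp add: pb)
  hence pp: "p \<bullet> p = n * c\<^sup>2" by (simp add: n_def power2_eq_square)
  have "affine hull (Basis::'a set) \<subseteq> {x. (\<Sum>b\<in>Basis. b) \<bullet> x = 1}"
  proof (rule hull_minimal)
    show "(Basis::'a set) \<subseteq> {x. (\<Sum>b\<in>Basis. b) \<bullet> x = 1}"
      by (auto simp: inner_sum_left inner_Basis if_distrib cong: if_cong)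
  qed (rule affine_hyperplane)
  moreover have "(\<Sum>b\<in>Basis. b) \<bullet> p = n * c"
    by (subst inner_commute) (simp add: inner_sum_right pb n_def)
  ultimately have pnot: "p \<notin> affine hull Basis" using nc by auto
  have "\<not> affine_dependent (Basis::'a set)"
    using independent_Basis affine_dependent_imp_dependent by blast
  hence ai: "\<not> affine_dependent (insert p Basis)"
    using pnot by (rule affine_independent_insert)
  have pn: "p \<notin> Basis" using pnot hull_inc[of p Basis affine] by auto
  have d1: "dist x y = sqrt 2" if "x \<in> Basis" "y \<in> Basis" "x \<noteq> y" for x y :: 'a
    using that by (simp add: dist_norm norm_eq_sqrt_inner inner_diff inner_Basis)
  have d2: "dist x p = sqrt 2" if "x \<in> Basis" for x
  proof -
    have "(x - p) \<bullet> (x - p) = x \<bullet> x - 2 * (p \<bullet> x) + p \<bullet> p"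
      by (simp add: inner_diff_left inner_diff_right inner_commute)
    also have "\<dots> = 2" using that c by (simp add: pb pp)
    finally show ?thesis by (simp add: dist_norm norm_eq_sqrt_inner)
  qed
  have "dist x y = sqrt 2" if "x \<in> insert p Basis" "y \<in> insert p Basis" "x \<noteq> y" for x y
    using that d1[of x y] d2[of x] d2[of y] dist_commute[of p y] by force
  moreover have "card (insert p (Basis::'a set)) = DIM('a) + 1"
    using pn by simp
  ultimately have "regular_simplex (convex hull (insert p Basis))"
    unfolding regular_simplex_def using ai
    by (intro exI[of _ "insert p Basis"] exI[of _ "sqrt 2"]) simp
  thus ?thesis ..
qed

end

theory Submission
  imports Defs
begin

text \<open>
Write \<open>n\<close> for the dimension, \<open>K\<close> and \<open>L\<close> for the two bodies, and \<open>\<langle>x, y\<rangle>\<close> for the inner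
product. The proof turns both the bound \<open>n\<close> on the Gruenbaum distance and a lower bound near \<open>n\<close>
into finite systems of points and functionals, and shows that these two systems can only coexist
if they are clustered around the vertices and the facets of a simplex.

\<^emph>\<open>Primal data.\<close> Replace \<open>K\<close> by an affine image of maximal volume inside \<open>L\<close>
(\<open>maximal_volume_position\<close>). Extremality gives contact points \<open>x\<^sub>i\<close> of \<open>K\<close> with \<open>L\<close>, normals \<open>y\<^sub>i\<close>
in the polar body of \<open>L\<close> with \<open>\<langle>x\<^sub>i, y\<^sub>i\<rangle> = 1\<close>, and weights \<open>c\<^sub>i\<close> of total mass \<open>n\<close> such that
\<open>\<Sum> c\<^sub>i \<langle>u, y\<^sub>i\<rangle> x\<^sub>i = u\<close> for all \<open>u\<close> and \<open>\<Sum> c\<^sub>i y\<^sub>i = 0\<close>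
(\<open>extremal_position_imp_decomposition\<close>). Writing \<open>b = \<Sum> c\<^sub>i x\<^sub>i\<close>, the identity
\<open>b - x = \<Sum> c\<^sub>i (1 - \<langle>x, y\<^sub>i\<rangle>) x\<^sub>i\<close> shows \<open>b - L \<subseteq> n K\<close>, which is why the distance never exceeds \<open>n\<close>.

\<^emph>\<open>Dual data.\<close> If the distance is at least \<open>(1 - \<epsilon>) n\<close>, no homothet \<open>b - s K\<close> with
\<open>s < (1 - \<epsilon>) n\<close> contains \<open>L\<close>. A separation argument (\<open>homothet_certificate\<close>) turns this into
functionals \<open>f\<^sub>j\<close>, normal to \<open>L\<close> at points \<open>z\<^sub>j\<close>, and probability weights \<open>l\<^sub>j\<close> with
\<open>\<Sum> l\<^sub>j f\<^sub>j = 0\<close>, such that \<open>K\<close> lies in the half-spaces \<open>\<langle>u, f\<^sub>j\<rangle> + a\<^sub>j \<ge> 0\<close> and \<open>\<Sum> l\<^sub>j a\<^sub>j\<close> is at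
most \<open>1 / ((1 - \<epsilon>) n)\<close>.

\<^emph>\<open>The key identity.\<close> Put \<open>g\<^sub>i\<^sub>j = \<langle>x\<^sub>i, f\<^sub>j\<rangle> + a\<^sub>j \<ge> 0\<close>. Evaluating the decomposition of the identity
at \<open>z\<^sub>j\<close> and \<open>f\<^sub>j\<close> and averaging over \<open>j\<close> gives (\<open>defect_identity\<close>)
\<open>\<Sum> l\<^sub>j c\<^sub>i g\<^sub>i\<^sub>j (1 - \<langle>z\<^sub>j, y\<^sub>i\<rangle>) = n \<Sum> l\<^sub>j a\<^sub>j - 1 \<le> \<epsilon> / (1 - \<epsilon>)\<close>, a sum of nonnegative terms.
So for most pairs either \<open>y\<^sub>i\<close> is almost normal to \<open>L\<close> at \<open>z\<^sub>j\<close>, and then, \<open>L\<close> being smooth, close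
to \<open>f\<^sub>j\<close>; or \<open>x\<^sub>i\<close> almost lies on the facet \<open>\<langle>u, f\<^sub>j\<rangle> + a\<^sub>j = 0\<close>.

\<^emph>\<open>Clusters.\<close> The identity \<open>\<Sum>\<^sub>j l\<^sub>j g\<^sub>i\<^sub>j = \<Sum> l\<^sub>j a\<^sub>j\<close> (about \<open>1 / n\<close>) holds for every \<open>i\<close>, and \<open>g\<^sub>i\<^sub>j\<close>
is about \<open>1 + a\<^sub>j\<close> for close pairs. Hence each cluster of functionals has mass about \<open>1 / n\<close>
with respect to the weights \<open>l\<^sub>j (1 + a\<^sub>j)\<close>, whose total is about \<open>1 + 1 / n\<close>: there are at least
\<open>n + 1\<close> well separated clusters (\<open>separated_family\<close>). Averaging contact points and half-spaces
over \<open>n + 1\<close> of them gives points \<open>v\<^sub>k\<close> of \<open>K\<close> and affine functions nonnegative on \<open>K\<close> whose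
matrix of values is nearly diagonal (\<open>almost_simplex\<close>). Such a matrix forces the \<open>v\<^sub>k\<close> to be
affinely independent, and \<open>K\<close> to lie between the simplex that they span and a slightly larger
homothet (\<open>simplex_from_dominant_matrix\<close>).

The resulting estimate \<open>stability_of_simplices\<close> only uses that near-normality implies closeness of
functionals, with a threshold \<open>\<eta>\<close> and a distance \<open>t\<close>. For a smooth body these are supplied by the
modulus of convexity of the polar body at one fixed argument \<open>t\<close>, and then the error is linear in
\<open>\<epsilon> / \<eta>\<close>. Every \<open>r\<close> admissible in the theorem satisfies \<open>\<epsilon> / \<eta> \<le> r / (4 n)\<close>, because the modulus
is monotone. For ellipsoids, after centring, elementary Euclidean geometry supplies
\<open>\<eta> = t\<^sup>2 / 2\<close>.
\<close>

section \<open>Affine positions and homothetic simplices\<close>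

text \<open>The relation over which both distances are infima: the Banach-Mazur distance takes it for
\<open>r > 0\<close>, the Gruenbaum distance for real \<open>r\<close> of either sign. It is isolated because its
invariance under affine changes of \<open>K\<close> and translations of \<open>L\<close> serves both.\<close>

definition sandwiched :: "'a::euclidean_space set \<Rightarrow> 'a set \<Rightarrow> real \<Rightarrow> bool" where
  "sandwiched K L r \<longleftrightarrow> (\<exists>T u v. linear T \<and> bij T \<and>
      (\<lambda>x. x + u) ` K \<subseteq> T ` (\<lambda>x. x + v) ` L \<and>
      T ` (\<lambda>x. x + v) ` L \<subseteq> (*\<^sub>R) r ` (\<lambda>x. x + u) ` K)"

lemma banach_mazur_dist_le: "0 < r \<Longrightarrow> sandwiched K L r \<Longrightarrow> banach_mazur_dist K L \<le> r"
  unfolding banach_mazur_dist_def sandwiched_def by (rule cInf_lower) (auto intro!: bdd_belowI[of _ 0])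

lemma grunbaum_dist_le: "sandwiched K L r \<Longrightarrow> grunbaum_dist K L \<le> \<bar>r\<bar>"
  unfolding grunbaum_dist_def sandwiched_def by (rule cInf_lower) (auto intro!: bdd_belowI[of _ 0])

lemma linear_bij_inv:
  fixes T :: "'a::euclidean_space \<Rightarrow> 'a"
  assumes "linear T" "bij T"
  shows "linear (inv T)" "bij (inv T)" "\<And>x. T (inv T x) = x" "\<And>x. inv T (T x) = x"
proof -
  show 1: "\<And>x. T (inv T x) = x" using assms(2) by (simp add: bij_is_surj surj_f_inv_f)
  show 2: "\<And>x. inv T (T x) = x" using assms(2) by (simp add: bij_is_inj)
  show "bij (inv T)" using assms(2) by (rule bij_imp_bij_inv)
  show "linear (inv T)"
  proof
    show "inv T (x + y) = inv T x + inv T y" for x y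
      by (metis 1 2 linear_add[OF assms(1)])
    show "inv T (r *\<^sub>R x) = r *\<^sub>R inv T x" for r x
      by (metis 1 2 linear_scale[OF assms(1)])
  qed
qed

text \<open>Both inclusions can be transported by the inverse of the affine map; this is what allows \<open>K\<close> to be
replaced by its image of maximal volume.\<close>

lemma sandwiched_affine_image_left:
  fixes K L :: "'a::euclidean_space set"
  assumes T: "linear T" "bij T" and s: "sandwiched ((\<lambda>x. T x + d) ` K) L r"
  shows "sandwiched K L r"
proof -
  obtain U u v where U: "linear U" "bij U" 
    and 1: "(\<lambda>x. x + u) ` (\<lambda>x. T x + d) ` K \<subseteq> U ` (\<lambda>x. x + v) ` L"
    and 2: "U ` (\<lambda>x. x + v) ` L \<subseteq> (*\<^sub>R) r ` (\<lambda>x. x + u) ` (\<lambda>x. T x + d) ` K"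
    using s unfolding sandwiched_def by blast
  note T' = linear_bij_inv[OF T]
  define w where "w = inv T (d + u)"
  have eq: "x + w = inv T (T x + d + u)" for x
    by (simp add: w_def linear_add[OF T'(1)] T' add.assoc)
  have "(\<lambda>x. x + w) ` K \<subseteq> (inv T \<circ> U) ` (\<lambda>x. x + v) ` L"
  proof
    fix y assume "y \<in> (\<lambda>x. x + w) ` K"
    then obtain k where k: "k \<in> K" "y = inv T (T k + d + u)" using eq by auto
    have "T k + d + u \<in> U ` (\<lambda>x. x + v) ` L" using 1 k(1) by blast
    thus "y \<in> (inv T \<circ> U) ` (\<lambda>x. x + v) ` L" using k(2) by (metis imageI image_comp)
  qed
  moreover have "(inv T \<circ> U) ` (\<lambda>x. x + v) ` L \<subseteq> (*\<^sub>R) r ` (\<lambda>x. x + w) ` K"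
  proof
    fix y assume "y \<in> (inv T \<circ> U) ` (\<lambda>x. x + v) ` L"
    then obtain q where q: "q \<in> U ` (\<lambda>x. x + v) ` L" "y = inv T q" by auto
    then obtain k where k: "k \<in> K" "q = r *\<^sub>R (T k + d + u)" using 2 by blast
    have "y = r *\<^sub>R (k + w)" by (simp add: q(2) k(2) linear_scale[OF T'(1)] eq)
    thus "y \<in> (*\<^sub>R) r ` (\<lambda>x. x + w) ` K" using k(1) by blast
  qed
  moreover have "linear (inv T \<circ> U)" "bij (inv T \<circ> U)"
    using U T' linear_compose bij_comp by blast+
  ultimately show ?thesis unfolding sandwiched_def by blast
qed

text \<open>All nondegenerate simplices are affinely equivalent: the edge vectors from one vertex form a
basis, and any bijection of bases extends to a linear isomorphism.\<close>

lemma simplex_affine_equivalence: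
  fixes C W :: "'a::euclidean_space set"
  assumes C: "\<not> affine_dependent C" "card C = DIM('a) + 1"
    and W: "\<not> affine_dependent W" "card W = DIM('a) + 1"
  obtains T d where "linear T" "bij T" "W = (\<lambda>x. T x + d) ` C"
proof -
  have fin: "finite C" "finite W" using C W aff_independent_finite by auto
  obtain h where h: "bij_betw h C W" using fin C W finite_same_card_bij by metis
  have "C \<noteq> {}" using C by auto
  then obtain c where c: "c \<in> C" by blast
  define C' where "C' = C - {c}"
  have CC: "C = insert c C'" "c \<notin> C'" using c by (auto simp: C'_def)
  define B where "B = (\<lambda>x. - c + x) ` C'"
  have "independent B" using C(1) CC affine_dependent_iff_dependent[of c C'] unfolding B_def by simp
  then obtain T where T: "linear T" "\<forall>b\<in>B. T b = h (b + c) - h c"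
    using linear_independent_extend[of B "\<lambda>b. h (b + c) - h c"] by blast
  define d where "d = h c - T c"
  have im: "T x + d = h x" if "x \<in> C" for x
  proof (cases "x = c")
    case False
    hence "- c + x \<in> B" using that by (auto simp: B_def C'_def)
    hence "T (- c + x) = h x - h c" using T(2) by auto
    moreover have "T (- c + x) = T x - T c" using linear_diff[OF T(1), of x c] by simp
    ultimately have "T x - T c = h x - h c" by metis
    hence "T x = h x - h c + T c" by (simp only: diff_eq_eq)
    thus ?thesis by (simp only: d_def) simp
  qed (simp add: d_def)
  have W': "W = (\<lambda>x. T x + d) ` C" using h im by (force simp: bij_betw_def)
  have "(\<lambda>x. - h c + x) ` (W - {h c}) \<subseteq> range T"
  proof
    fix y assume "y \<in> (\<lambda>x. - h c + x) ` (W - {h c})"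
    then obtain x where "x \<in> C" "y = - h c + (T x + d)" using W' by auto
    hence "y = T (x - c)" by (simp add: d_def linear_diff[OF T(1)])
    thus "y \<in> range T" by simp
  qed
  moreover have "independent ((\<lambda>x. - h c + x) ` (W - {h c}))"
    using affine_dependent_iff_dependent[of "h c" "W - {h c}"] W(1) h c
    by (auto simp: bij_betw_def insert_absorb)
  moreover have "card ((\<lambda>x. - h c + x) ` (W - {h c})) = DIM('a)"
    using W(2) h c fin by (subst card_image) (auto simp: bij_betw_def inj_on_def)
  ultimately have "UNIV \<subseteq> span (range T)"
    using card_ge_dim_independent[of "(\<lambda>x. - h c + x) ` (W - {h c})" UNIV] span_mono 
    by (metis dim_UNIV dual_order.trans order_refl subset_UNIV)
  hence "surj T" using linear_subspace_image[OF T(1) subspace_UNIV] by (simp add: span_eq_iff[THEN iffD2] top.extremum_unique)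
  hence "bij T" using T(1) linear_surjective_imp_injective[OF T(1)] by (simp add: bij_def)
  with that T(1) W' show thesis by blast
qed

lemma sandwiched_regular_simplex:
  fixes K S :: "'a::euclidean_space set"
  assumes S: "regular_simplex S" and W: "\<not> affine_dependent W" "card W = DIM('a) + 1"
    and WK: "convex hull W \<subseteq> K" and KW: "K \<subseteq> (\<lambda>w. p + \<rho> *\<^sub>R (w - p)) ` (convex hull W)"
    and \<rho>: "0 < \<rho>"
  shows "sandwiched K S \<rho>"
proof -
  obtain C where C: "card C = DIM('a) + 1" "\<not> affine_dependent C" "S = convex hull C"
    using S by (auto simp: regular_simplex_def)
  obtain T d where T: "linear T" "bij T" and WT: "W = (\<lambda>x. T x + d) ` C"
    using simplex_affine_equivalence[OF C(2,1) W] by blast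
  have "(\<lambda>x. x + d) ` T ` S = (\<lambda>x. x + d) ` (convex hull (T ` C))"
    unfolding C(3) using convex_hull_linear_image[OF T(1)] by simp
  also have "\<dots> = convex hull W"
    unfolding WT image_image[symmetric, of "\<lambda>x. x + d" T] 
    using convex_hull_translation[of d "T ` C"] by (simp add: add.commute)
  finally have V: "convex hull W = (\<lambda>x. T x + d) ` S" by (simp add: image_image)
  define v where "v = inv T (d - p)"
  have Tv: "T v = d - p" using linear_bij_inv[OF T] by (simp add: v_def)
  define U where "U = (\<lambda>x. \<rho> *\<^sub>R T x)"
  have U: "linear U" "bij U"
  proof -
    show "linear U" unfolding U_def by (rule linear_compose_scale_right[OF T(1)])
    have "bij ((*\<^sub>R) \<rho> :: 'a \<Rightarrow> 'a)" 
      by (rule bij_betw_byWitness[of _ "(*\<^sub>R) (1/\<rho>)"]) (use \<rho> in auto)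
    from bij_comp[OF T(2) this] show "bij U" by (simp add: U_def comp_def)
  qed
  have US: "U ` (\<lambda>x. x + v) ` S = (\<lambda>w. \<rho> *\<^sub>R (w - p)) ` (convex hull W)"
    unfolding V image_image U_def by (simp add: linear_add[OF T(1)] Tv algebra_simps)
  have "(\<lambda>x. x + (- p)) ` K \<subseteq> U ` (\<lambda>x. x + v) ` S"
    unfolding US using KW by force
  moreover have "U ` (\<lambda>x. x + v) ` S \<subseteq> (*\<^sub>R) \<rho> ` (\<lambda>x. x + (- p)) ` K"
    unfolding US using WK by force
  ultimately show ?thesis unfolding sandwiched_def using U by blast
qed

text \<open>The affine functions \<open>\<langle>u, \<phi> k\<rangle> + \<alpha> k\<close> play the role of the facets of a simplex with vertices \<open>v k\<close>.
Diagonal dominance of the matrix of their values makes the vertices affinely independent. For a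
point \<open>u\<close> of \<open>K\<close> with smallest barycentric coordinate \<open>- s\<close> at \<open>q\<close>, nonnegativity of the function
belonging to \<open>q\<close> gives \<open>s H \<le> (1 + s + DIM s) \<gamma>\<close>, so \<open>s \<le> \<mu>\<close>. The points all of whose barycentric
coordinates are at least \<open>- \<mu>\<close> form the homothet of the simplex with ratio \<open>1 + (DIM + 1) \<mu>\<close> about
its centroid.\<close>

lemma simplex_from_dominant_matrix:
  fixes K :: "'a::euclidean_space set" and v \<phi> :: "'k \<Rightarrow> 'a" and \<alpha> :: "'k \<Rightarrow> real" and H \<gamma> \<mu> :: real
  assumes S: "regular_simplex S" and K: "convex K"
    and P: "finite P" "card P = DIM('a) + 1"
    and vK: "\<And>k. k \<in> P \<Longrightarrow> v k \<in> K"
    and Kpos: "\<And>k u. k \<in> P \<Longrightarrow> u \<in> K \<Longrightarrow> 0 \<le> u \<bullet> \<phi> k + \<alpha> k"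
    and diag: "\<And>k. k \<in> P \<Longrightarrow> H \<le> v k \<bullet> \<phi> k + \<alpha> k"
    and off: "\<And>k m. k \<in> P \<Longrightarrow> m \<in> P \<Longrightarrow> m \<noteq> k \<Longrightarrow> v m \<bullet> \<phi> k + \<alpha> k \<le> \<gamma>"
    and \<gamma>: "0 \<le> \<gamma>" and dom: "(DIM('a) + 1) * \<gamma> < H"
    and mu: "\<gamma> \<le> \<mu> * (H - (DIM('a) + 1) * \<gamma>)"
  shows "sandwiched K S (1 + (DIM('a) + 1) * \<mu>)"
proof -
  define h where "h m k = v m \<bullet> \<phi> k + \<alpha> k" for m k
  have h0: "0 \<le> h m k" if "m \<in> P" "k \<in> P" for m k using Kpos vK that by (simp add: h_def)
  have m0: "0 \<le> \<mu>"
  proof (rule ccontr)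
    assume "\<not> 0 \<le> \<mu>"
    hence "\<mu> * (H - (DIM('a) + 1) * \<gamma>) < 0" using dom by (simp add: mult_neg_pos)
    thus False using mu \<gamma> by linarith
  qed
  have eval: "(\<Sum>m\<in>P. b m * h m k) = (\<Sum>m\<in>P. b m *\<^sub>R v m) \<bullet> \<phi> k + sum b P * \<alpha> k" for b k
    by (simp add: h_def distrib_left sum.distrib inner_sum_left sum_distrib_right)
  have split: "(\<Sum>m\<in>P. F m) = F k + (\<Sum>m\<in>P - {k}. F m)" if "k \<in> P" for k and F :: "'k \<Rightarrow> real"
    using sum.remove[OF P(1) that] .
  have card': "card (P - {k}) = DIM('a)" if "k \<in> P" for k using P that by simp
  have P0: "P \<noteq> {}" using P by auto
  have indep: "b k = 0" if b: "sum b P = 0" "(\<Sum>m\<in>P. b m *\<^sub>R v m) = 0" and kP: "k \<in> P" for b k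
  proof -
    have "Max ((\<lambda>k. \<bar>b k\<bar>) ` P) \<in> (\<lambda>k. \<bar>b k\<bar>) ` P" using P(1) P0 by simp
    then obtain q where q: "q \<in> P" "\<bar>b q\<bar> = Max ((\<lambda>k. \<bar>b k\<bar>) ` P)" by force
    have qmax: "\<bar>b k\<bar> \<le> \<bar>b q\<bar>" if "k \<in> P" for k
      unfolding q(2) using P(1) that by simp
    have "0 = (\<Sum>m\<in>P. b m * h m q)" unfolding eval by (simp add: b)
    also have "\<dots> = b q * h q q + (\<Sum>m\<in>P - {q}. b m * h m q)" by (rule split[OF q(1)])
    finally have "\<bar>b q * h q q\<bar> = \<bar>\<Sum>m\<in>P - {q}. b m * h m q\<bar>" by linarith
    also have "\<dots> \<le> (\<Sum>m\<in>P - {q}. \<bar>b m * h m q\<bar>)" by (rule sum_abs)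
    also have "\<dots> \<le> (\<Sum>m\<in>P - {q}. \<bar>b q\<bar> * \<gamma>)"
    proof (rule sum_mono)
      fix m assume mP: "m \<in> P - {q}"
      hence "h m q \<le> \<gamma>" using off[OF q(1), of m] by (simp add: h_def)
      thus "\<bar>b m * h m q\<bar> \<le> \<bar>b q\<bar> * \<gamma>"
        unfolding abs_mult using qmax mP h0[of m q] q(1) by (intro mult_mono) auto
    qed
    also have "\<dots> = \<bar>b q\<bar> * (DIM('a) * \<gamma>)" using card'[OF q(1)] by simp
    finally have "\<bar>b q\<bar> * h q q \<le> \<bar>b q\<bar> * (DIM('a) * \<gamma>)" using h0[OF q(1) q(1)] by (simp add: abs_mult)
    moreover have "DIM('a) * \<gamma> < h q q"
      using diag[OF q(1)] dom \<gamma> by (simp add: h_def algebra_simps)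
    ultimately have "b q = 0" by (simp add: mult_le_cancel_left)
    thus "b k = 0" using qmax[OF kP] by simp
  qed
  have "\<gamma> < H"
  proof -
    have "1 * \<gamma> \<le> (DIM('a) + 1) * \<gamma>" using \<gamma> by (intro mult_right_mono) auto
    thus ?thesis using dom by linarith
  qed
  hence inj: "inj_on v P"
    using diag off by (force intro!: inj_onI simp: not_less)
  define W where "W = v ` P"
  have W: "card W = DIM('a) + 1" "finite W" using inj P by (auto simp: W_def card_image)
  have aff: "\<not> affine_dependent W"
    unfolding affine_dependent_explicit_finite[OF W(2)]
  proof (clarify)
    fix U x assume U: "sum U W = 0" "(\<Sum>v\<in>W. U v *\<^sub>R v) = 0" and x: "x \<in> W" "U x \<noteq> 0"
    obtain k where k: "k \<in> P" "x = v k" using x by (auto simp: W_def)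
    have "(U \<circ> v) k = 0"
    proof (rule indep[OF _ _ k(1)])
      show "sum (U \<circ> v) P = 0" using U(1) by (simp add: W_def sum.reindex[OF inj])
      show "(\<Sum>m\<in>P. (U \<circ> v) m *\<^sub>R v m) = 0" using U(2) by (simp add: W_def sum.reindex[OF inj] comp_def)
    qed
    thus False using x k by simp
  qed
  define \<rho> where "\<rho> = 1 + (DIM('a) + 1) * \<mu>"
  have \<rho>: "0 < \<rho>" using m0 by (simp add: \<rho>_def add_pos_nonneg)
  define p where "p = (1 / (DIM('a) + 1)) *\<^sub>R (\<Sum>k\<in>P. v k)"
  have pm: "(\<rho> - 1) *\<^sub>R p = \<mu> *\<^sub>R (\<Sum>k\<in>P. v k)"
    unfolding p_def \<rho>_def by (simp add: field_simps)
  have "K \<subseteq> (\<lambda>w. p + \<rho> *\<^sub>R (w - p)) ` (convex hull W)"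
  proof
    fix u assume u: "u \<in> K"
    have "u \<in> affine hull W" using affine_independent_span_eq[OF aff] W by simp
    then obtain U where U: "sum U W = 1" "(\<Sum>v\<in>W. U v *\<^sub>R v) = u"
      unfolding affine_hull_finite[OF W(2)] by blast
    define b where "b = U \<circ> v"
    have b: "sum b P = 1" "(\<Sum>m\<in>P. b m *\<^sub>R v m) = u"
      using U by (simp_all add: W_def b_def sum.reindex[OF inj])
    have bm: "- \<mu> \<le> b k" if kP: "k \<in> P" for k
    proof -
      have "Min (b ` P) \<in> b ` P" using P(1) P0 by simp
      then obtain q where q: "q \<in> P" "b q = Min (b ` P)" by force
      have qmin: "b q \<le> b k" if "k \<in> P" for k unfolding q(2) using P(1) that by simp
      have "- \<mu> \<le> b q"
      proof (cases "0 \<le> b q")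
        case False
        define s where "s = - b q"
        have s: "0 < s" using False by (simp add: s_def)
        have "0 \<le> (\<Sum>m\<in>P. b m * h m q)" unfolding eval using Kpos[OF q(1) u] b by simp
        also have "\<dots> = b q * h q q + (\<Sum>m\<in>P - {q}. b m * h m q)" by (rule split[OF q(1)])
        also have "(\<Sum>m\<in>P - {q}. b m * h m q) \<le> (\<Sum>m\<in>P - {q}. (b m + s) * \<gamma>)"
        proof (rule sum_mono)
          fix m assume mP: "m \<in> P - {q}"
          \<comment> \<open>adding \<open>s\<close> makes all coordinates nonnegative, so that the off-diagonal entries can be bounded by \<open>\<gamma>\<close>\<close>
          have "b m * h m q \<le> (b m + s) * h m q" using s h0 mP q by (intro mult_right_mono) auto
          also have "\<dots> \<le> (b m + s) * \<gamma>"
            using off[OF q(1), of m] mP qmin[of m] by (intro mult_left_mono) (auto simp: h_def s_def)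
          finally show "b m * h m q \<le> (b m + s) * \<gamma>" .
        qed
        also have "\<dots> = (sum b (P - {q}) + DIM('a) * s) * \<gamma>"
          using card'[OF q(1)] by (simp add: sum_distrib_right[symmetric] sum.distrib)
        also have "sum b (P - {q}) = 1 + s" using split[OF q(1), of b] b by (simp add: s_def)
        finally have "s * h q q \<le> (1 + s + DIM('a) * s) * \<gamma>" by (simp add: s_def)
        moreover have "s * H \<le> s * h q q" using diag[OF q(1)] s by (simp add: h_def)
        ultimately have "s * (H - (DIM('a) + 1) * \<gamma>) \<le> \<gamma>" by (simp add: algebra_simps)
        hence "s * (H - (DIM('a) + 1) * \<gamma>) \<le> \<mu> * (H - (DIM('a) + 1) * \<gamma>)" using mu by linarith
        hence "s \<le> \<mu>" using dom by simp
        thus ?thesis by (simp add: s_def)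
      qed (use m0 in simp)
      thus ?thesis using qmin[OF kP] by linarith
    qed
    define w where "w = (\<Sum>k\<in>P. ((b k + \<mu>) / \<rho>) *\<^sub>R v k)"
    have w: "w \<in> convex hull W"
      unfolding w_def
    proof (rule convex_sum)
      have "(\<Sum>k\<in>P. b k + \<mu>) = \<rho>" using b P by (simp add: sum.distrib \<rho>_def algebra_simps)
      thus "(\<Sum>k\<in>P. (b k + \<mu>) / \<rho>) = 1" using \<rho> by (simp add: sum_divide_distrib[symmetric])
    qed (use P bm \<rho> in \<open>auto intro!: hull_inc divide_nonneg_pos simp: W_def\<close>, use bm in force)
    have "\<rho> *\<^sub>R w = (\<Sum>k\<in>P. (b k + \<mu>) *\<^sub>R v k)"
      using \<rho> by (simp add: w_def scaleR_sum_right)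
    also have "\<dots> = u + (\<rho> - 1) *\<^sub>R p"
      unfolding pm by (simp add: scaleR_add_left sum.distrib b scaleR_sum_right)
    finally have "u = p + \<rho> *\<^sub>R (w - p)" by (simp add: algebra_simps)
    with w show "u \<in> (\<lambda>w. p + \<rho> *\<^sub>R (w - p)) ` (convex hull W)" by blast
  qed
  moreover have "convex hull W \<subseteq> K"
    using vK K by (intro hull_minimal) (auto simp: W_def)
  ultimately show ?thesis
    using sandwiched_regular_simplex[OF S aff W(1)] \<rho> unfolding \<rho>_def by blast
qed

text \<open>The Gruenbaum distance does not see the position of \<open>L\<close>, so an ellipsoid may be centred.\<close>

lemma sandwiched_translate_right:
  "sandwiched K ((\<lambda>x. x + c) ` L) r \<longleftrightarrow> sandwiched K L r"
proof -
  have "(\<lambda>x. x + v) ` (\<lambda>x. x + c) ` L = (\<lambda>x. x + (c + v)) ` L" for v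
    by (simp add: image_image add.assoc)
  note shift = this
  have "sandwiched K L r" if "sandwiched K ((\<lambda>x. x + c) ` L) r"
    using that unfolding sandwiched_def shift by blast
  moreover have "sandwiched K ((\<lambda>x. x + c) ` L) r" if s: "sandwiched K L r"
  proof -
    obtain T u v where T: "linear T" "bij T" "(\<lambda>x. x + u) ` K \<subseteq> T ` (\<lambda>x. x + (c + (v - c))) ` L"
      "T ` (\<lambda>x. x + (c + (v - c))) ` L \<subseteq> (*\<^sub>R) r ` (\<lambda>x. x + u) ` K"
      using s unfolding sandwiched_def by auto
    thus ?thesis unfolding sandwiched_def shift by blast
  qed
  ultimately show ?thesis by blast
qed

lemma grunbaum_dist_translate: "grunbaum_dist K ((\<lambda>x. x + c) ` L) = grunbaum_dist K L"
  using sandwiched_translate_right[of K c L]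
  by (simp add: grunbaum_dist_def sandwiched_def)

section \<open>Polar bodies and supporting functionals\<close>

text \<open>The half of the bipolar theorem that is needed to test membership in \<open>L\<close> by its polar body.\<close>

lemma polar_separation:
  fixes L :: "'a::euclidean_space set"
  assumes "convex L" "closed L" "0 \<in> L" "z \<notin> L"
  obtains y where "y \<in> polar_body L" "1 < z \<bullet> y"
proof -
  obtain a b where ab: "a \<bullet> z < b" "\<And>x. x \<in> L \<Longrightarrow> b < a \<bullet> x"
    using separating_hyperplane_closed_point[OF assms(1,2,4)] by blast
  have b: "b < 0" using ab(2)[OF assms(3)] by simp
  show thesis
  proof (rule that[of "(1 / b) *\<^sub>R a"])
    show "1 < z \<bullet> (1 / b) *\<^sub>R a" using ab(1) b by (simp add: inner_commute field_simps)
    show "(1 / b) *\<^sub>R a \<in> polar_body L"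
      using ab(2) b by (auto simp: polar_body_def field_simps inner_commute less_imp_le)
  qed
qed

lemma closed_polar: "closed (polar_body L)"
proof -
  have "polar_body L = (\<Inter>y\<in>L. {x. x \<bullet> y \<le> 1})" by (auto simp: polar_body_def)
  thus ?thesis by (auto intro!: closed_INT closed_Collect_le continuous_intros)
qed

lemma compact_polar:
  fixes L :: "'a::euclidean_space set"
  assumes "0 \<in> interior L" shows "compact (polar_body L)"
proof -
  obtain r where r: "0 < r" "cball 0 r \<subseteq> L" using assms mem_interior_cball by blast
  have "norm y \<le> 1 / r" if y: "y \<in> polar_body L" for y
  proof (cases "y = 0")
    case False
    have "(r / norm y) *\<^sub>R y \<in> L" using r False by auto
    hence "y \<bullet> (r / norm y) *\<^sub>R y \<le> 1" using y by (auto simp: polar_body_def)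
    hence "r * norm y \<le> 1" using False by (simp add: power2_norm_eq_inner[symmetric] power2_eq_square)
    thus ?thesis using r by (simp add: field_simps)
  qed (use r in simp)
  hence "bounded (polar_body L)" by (auto simp: bounded_iff)
  thus ?thesis using closed_polar compact_eq_bounded_closed by blast
qed

text \<open>Every nonzero direction is a positive multiple of a boundary functional of the polar body, that
is, one that attains the value one on \<open>L\<close>.\<close>

lemma supporting_functional:
  fixes L :: "'a::euclidean_space set"
  assumes L: "compact L" "0 \<in> interior L" and g: "g \<noteq> 0"
  obtains h z where "0 < h" "(1 / h) *\<^sub>R g \<in> polar_body L" "z \<in> L" "z \<bullet> (1 / h) *\<^sub>R g = 1"
proof -
  have "0 \<in> L" using L(2) interior_subset by blast
  hence "\<exists>z\<in>L. \<forall>x\<in>L. x \<bullet> g \<le> z \<bullet> g"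
    by (intro continuous_attains_sup L continuous_intros) auto
  then obtain z where z: "z \<in> L" "\<And>x. x \<in> L \<Longrightarrow> x \<bullet> g \<le> z \<bullet> g" by blast
  obtain r where r: "0 < r" "cball 0 r \<subseteq> L" using L(2) mem_interior_cball by blast
  have "(r / norm g) *\<^sub>R g \<in> L" using r g by auto
  from z(2)[OF this] have "r * norm g \<le> z \<bullet> g" using g 
    by (simp add: power2_norm_eq_inner[symmetric] power2_eq_square)
  moreover have "0 < r * norm g" using r g by simp
  ultimately have h: "0 < z \<bullet> g" by linarith
  show thesis
  proof (rule that[OF h _ z(1)])
    show "(1 / (z \<bullet> g)) *\<^sub>R g \<in> polar_body L"
      using z(2) h by (auto simp: polar_body_def inner_commute field_simps)
    show "z \<bullet> (1 / (z \<bullet> g)) *\<^sub>R g = 1" using h by simp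
  qed
qed

section \<open>Positions of maximal volume and the decomposition of the identity\<close>

text \<open>The matrix of \<open>u \<mapsto> \<langle>x, u\<rangle> y\<close>; the order of the indices is chosen so that the inner product with
\<open>A\<close> is \<open>\<langle>A x, y\<rangle>\<close>.\<close>

definition outer :: "real^'n \<Rightarrow> real^'n \<Rightarrow> real^'n^'n" where
  "outer x y = (\<chi> i j. y $ i * x $ j)"

lemma inner_outer: "A \<bullet> outer x y = (A *v x) \<bullet> y"
  unfolding outer_def inner_vec_def matrix_vector_mult_def
  by (simp add: sum_distrib_right) (simp only: mult_ac)

text \<open>In the Leibniz expansion a permutation other than the identity moves at least two indices, so
its product has a zero of order at least two at \<open>s = 0\<close>; only the diagonal product contributes.\<close>

lemma det_derivative_at_identity:
  fixes A :: "real^'n^'n"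
  shows "((\<lambda>s. det (mat 1 + s *\<^sub>R A)) has_real_derivative trace A) (at 0)"
proof -
  define F where "F p i s = (mat 1 + s *\<^sub>R A) $ i $ p i" for p :: "'n \<Rightarrow> 'n" and i and s :: real
  have F: "(F p i has_real_derivative A $ i $ p i) (at 0)" for p i
    unfolding F_def by (auto intro!: derivative_eq_intros)
  have F0: "F p i 0 = (if p i = i then 1 else 0)" for p i
    by (auto simp: F_def mat_def)
  let ?D = "\<lambda>p. \<Sum>i\<in>UNIV. A $ i $ p i * (\<Prod>j\<in>UNIV - {i}. F p j 0)"
  have D: "?D p = (if p = id then trace A else 0)" if p: "p permutes (UNIV :: 'n set)" for p
  proof (cases "p = id")
    case False
    have "(\<Prod>j\<in>UNIV - {i}. F p j 0) = 0" for i
    proof (rule ccontr)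
      assume "(\<Prod>j\<in>UNIV - {i}. F p j 0) \<noteq> 0"
      hence other: "p j = j" if "j \<noteq> i" for j using that F0[of p j] by (auto split: if_splits)
      have "p i = i"
      proof (rule ccontr)
        assume "p i \<noteq> i"
        hence "p (p i) = p i" by (rule other)
        thus False using \<open>p i \<noteq> i\<close> permutes_inj[OF p] by (auto dest: injD)
      qed
      with other have "p = id" by (metis eq_id_iff)
      with False show False by simp
    qed
    thus ?thesis using False by (simp only: mult_zero_right sum.neutral_const if_False)
  qed (simp add: F0 trace_def)
  have P: "((\<lambda>s. \<Prod>i\<in>UNIV. F p i s) has_real_derivative ?D p) (at 0)" for p
    by (rule has_field_derivative_prod) (rule F)
  have "((\<lambda>s. \<Sum>p | p permutes UNIV. of_int (sign p) * (\<Prod>i\<in>UNIV. F p i s)) has_real_derivative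
         (\<Sum>p | p permutes (UNIV :: 'n set). of_int (sign p) * ?D p)) (at 0)"
    by (rule DERIV_sum, rule DERIV_cmult, rule P)
  also have "(\<Sum>p | p permutes (UNIV :: 'n set). of_int (sign p) * ?D p) = 
             (\<Sum>p | p permutes (UNIV :: 'n set). if p = id then trace A else 0)"
    
  proof (rule sum.cong)
    fix p :: "'n \<Rightarrow> 'n" assume "p \<in> {p. p permutes UNIV}"
    hence "?D p = (if p = id then trace A else 0)" by (intro D) simp
    thus "of_int (sign p) * ?D p = (if p = id then trace A else 0)"
      by (simp only:) (simp add: sign_id)
  qed simp
  also have "\<dots> = trace A"
    by (simp add: permutes_id)
  finally show ?thesis by (simp add: det_def F_def)
qed

text \<open>John's theorem for a general pair of bodies. If the decomposition did not exist, the point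
\<open>(Id / n, 0)\<close> could be separated from the convex hull of the pairs \<open>(outer x y, y)\<close> over all contact
pairs. The separating functional is a matrix with a translation, and after subtracting a multiple
of the identity it gives an infinitesimal affine motion that moves all contact points strictly
inwards but has positive trace. A small multiple of it keeps \<open>K\<close> inside \<open>L\<close> and increases the
volume.\<close>

lemma extremal_position_imp_decomposition:
  fixes K L :: "(real^'n) set"
  assumes K: "compact K" and L: "convex L" "closed L" "0 \<in> interior L" and KL: "K \<subseteq> L"
    and extremal: "\<And>A w. (\<And>x. x \<in> K \<Longrightarrow> A *v x + w \<in> L) \<Longrightarrow> det A \<le> 1"
  obtains I :: "nat set" and c :: "nat \<Rightarrow> real" and x y where
    "finite I" "\<And>i. i \<in> I \<Longrightarrow> 0 \<le> c i" "sum c I = CARD('n)"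
    "\<And>i. i \<in> I \<Longrightarrow> x i \<in> K" "\<And>i. i \<in> I \<Longrightarrow> y i \<in> polar_body L" "\<And>i. i \<in> I \<Longrightarrow> x i \<bullet> y i = 1"
    "\<And>u. (\<Sum>i\<in>I. (c i * (u \<bullet> y i)) *\<^sub>R x i) = u" "(\<Sum>i\<in>I. c i *\<^sub>R y i) = 0"
proof -
  define n where "n = real CARD('n)"
  have n: "0 < n" by (simp add: n_def)
  have cP: "compact (polar_body L)" by (rule compact_polar[OF L(3)])
  have le1: "x \<bullet> y \<le> 1" if "x \<in> K" "y \<in> polar_body L" for x y
    using that KL by (auto simp: polar_body_def inner_commute)
  define R where "R = K \<times> polar_body L"
  have cR: "compact R" unfolding R_def by (rule compact_Times[OF K cP])
  define C where "C = R \<inter> {p. fst p \<bullet> snd p = 1}"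
  have "closed {p :: (real^'n) \<times> (real^'n). fst p \<bullet> snd p = 1}"
    by (intro closed_Collect_eq continuous_intros)
  hence cC: "compact C" unfolding C_def by (rule compact_Int_closed[OF cR])
  define \<Phi> where "\<Phi> p = (outer (fst p) (snd p), snd p)" for p :: "(real^'n) \<times> (real^'n)"
  have "continuous_on C \<Phi>"
    unfolding \<Phi>_def outer_def by (intro continuous_intros continuous_on_vec_lambda)
  hence cH: "compact (convex hull (\<Phi> ` C))"
    by (intro compact_convex_hull compact_continuous_image cC)
  have mem: "((1 / n) *\<^sub>R mat 1, 0) \<in> convex hull (\<Phi> ` C)"
  proof (rule ccontr)
    assume "\<not> ?thesis"
    then obtain q b where "q \<bullet> ((1 / n) *\<^sub>R mat 1, 0) < b" 
      and "\<forall>p\<in>convex hull (\<Phi> ` C). b < q \<bullet> p"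
      using separating_hyperplane_closed_point[OF convex_convex_hull compact_imp_closed[OF cH]] by blast
    moreover obtain A w where q: "q = (A, w)" by (cases q)
    ultimately have 1: "A \<bullet> ((1 / n) *\<^sub>R mat 1) < b" 
      and "\<And>p. p \<in> convex hull (\<Phi> ` C) \<Longrightarrow> b < (A, w) \<bullet> p" by auto
    hence 2: "b < (A *v x) \<bullet> y + w \<bullet> y" if "(x, y) \<in> C" for x y
      using that hull_inc[of "\<Phi> (x, y)" "\<Phi> ` C" convex] by (force simp: \<Phi>_def inner_outer)
    have "A \<bullet> mat 1 = trace A"
      by (simp add: inner_vec_def trace_def mat_def if_distrib if_distribR cong: if_cong)
    hence tr: "trace A < n * b" using 1 n by (simp add: field_simps)
    \<comment> \<open>the motion opposite to the separating matrix, with a multiple of the identity added that makes its trace positive\<close>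
    define B where "B = mat b - A"
    have trB: "0 < trace B"
      using tr by (simp add: B_def trace_def mat_def sum_subtractf n_def)
    have Bx: "B *v x = b *\<^sub>R x - A *v x" for x
    proof -
      have "mat b *v x = b *\<^sub>R x"
        by (simp add: vec_eq_iff matrix_vector_mult_def mat_def if_distrib if_distribR cong: if_cong)
      thus ?thesis by (simp add: B_def matrix_vector_mult_diff_rdistrib)
    qed
    define \<psi> where "\<psi> p = (B *v fst p - w) \<bullet> snd p" for p
    have contB: "continuous_on X (\<lambda>p. B *v f p)" if "continuous_on X f" for X :: "((real^'n) \<times> (real^'n)) set" and f :: "_ \<Rightarrow> real^'n"
      using linear_continuous_on_compose[OF that] matrix_vector_mul_linear by blast
    have cont\<psi>: "continuous_on X \<psi>" for X
      unfolding \<psi>_def by (intro continuous_intros contB)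
    have neg: "\<psi> p < 0" if "p \<in> C" for p
      using 2[of "fst p" "snd p"] that by (auto simp: \<psi>_def Bx inner_diff_left C_def)
    \<comment> \<open>pairs that the motion could push outwards; by compactness they stay away from contact\<close>
    define D where "D = R \<inter> {p. 0 \<le> \<psi> p}"
    have "closed {p. 0 \<le> \<psi> p}" using cont\<psi> by (intro closed_Collect_le continuous_intros) auto
    hence cD: "compact D" unfolding D_def by (rule compact_Int_closed[OF cR])
    obtain m where m: "m < 1" "\<And>p. p \<in> D \<Longrightarrow> fst p \<bullet> snd p \<le> m"
    proof (cases "D = {}")
      case False
      obtain p where p: "p \<in> D" "\<And>q. q \<in> D \<Longrightarrow> fst q \<bullet> snd q \<le> fst p \<bullet> snd p"
        using continuous_attains_sup[OF cD False continuous_on_inner[OF continuous_on_fst[OF continuous_on_id]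
            continuous_on_snd[OF continuous_on_id]]] by blast
      have "fst p \<bullet> snd p \<noteq> 1" using neg[of p] p(1) by (force simp: D_def C_def)
      moreover have "fst p \<bullet> snd p \<le> 1" using le1 p(1) by (auto simp: D_def R_def)
      ultimately show ?thesis using that[of "fst p \<bullet> snd p"] p(2) by auto
    qed (use that[of 0] in auto)
    have "bounded (\<psi> ` R)" by (intro compact_imp_bounded compact_continuous_image cont\<psi> cR)
    then obtain M where M: "0 < M" "\<And>p. p \<in> R \<Longrightarrow> \<bar>\<psi> p\<bar> \<le> M" 
      by (auto simp: bounded_pos)
    have fits: "det (mat 1 + s *\<^sub>R B) \<le> 1" if s: "0 < s" "s \<le> (1 - m) / M" for s
    proof (rule extremal)
      fix x assume x: "x \<in> K"
      show "(mat 1 + s *\<^sub>R B) *v x + (- s) *\<^sub>R w \<in> L"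
      proof (rule ccontr)
        assume neg': "\<not> ?thesis"
        have "0 \<in> L" using L(3) interior_subset by blast
        then obtain y where y: "y \<in> polar_body L" "1 < ((mat 1 + s *\<^sub>R B) *v x + (- s) *\<^sub>R w) \<bullet> y"
          using polar_separation[OF L(1,2) _ neg'] by blast
        have "((mat 1 + s *\<^sub>R B) *v x + (- s) *\<^sub>R w) \<bullet> y = x \<bullet> y + s * \<psi> (x, y)"
          by (simp add: \<psi>_def matrix_vector_mult_add_rdistrib scaleR_matrix_vector_assoc[symmetric]
               inner_add_left inner_diff_left algebra_simps)
        with y have gt: "1 < x \<bullet> y + s * \<psi> (x, y)" by simp
        have pR: "(x, y) \<in> R" using x y by (simp add: R_def)
        show False
        proof (cases "0 \<le> \<psi> (x, y)")
          case True
          hence "x \<bullet> y \<le> m" using m(2)[of "(x, y)"] pR by (simp add: D_def)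
          moreover have "s * \<psi> (x, y) \<le> (1 - m) / M * M"
            using M pR s m True by (intro mult_mono) (auto dest: M(2))
          ultimately show False using gt M(1) by simp
        next
          case False
          hence "s * \<psi> (x, y) \<le> 0" using s by (simp add: mult_nonneg_nonpos)
          thus False using gt le1[OF x y(1)] by linarith
        qed
      qed
    qed
    obtain d where d: "0 < d" "\<And>h. 0 < h \<Longrightarrow> h < d \<Longrightarrow> det (mat 1 + 0 *\<^sub>R B) < det (mat 1 + (0 + h) *\<^sub>R B)"
      using DERIV_pos_inc_right[OF det_derivative_at_identity trB] by blast
    define s where "s = min (d / 2) ((1 - m) / M)"
    have "0 < s" "s < d" "s \<le> (1 - m) / M" using d m M by (auto simp: s_def)
    thus False using d(2)[of s] fits[of s] by simp
  qed
  obtain k u q where q: "\<forall>i\<in>{1::nat..k}. 0 \<le> u i \<and> q i \<in> \<Phi> ` C" "sum u {1..k} = 1"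
    "(\<Sum>i = 1..k. u i *\<^sub>R q i) = ((1 / n) *\<^sub>R mat 1, 0)"
    using mem unfolding convex_hull_indexed by blast
  have "\<forall>i\<in>{1..k}. \<exists>p. p \<in> C \<and> q i = \<Phi> p" using q(1) by blast
  then obtain p where p: "\<And>i. i \<in> {1..k} \<Longrightarrow> p i \<in> C" "\<And>i. i \<in> {1..k} \<Longrightarrow> q i = \<Phi> (p i)" by metis
  have sumPhi: "(\<Sum>i = 1..k. u i *\<^sub>R \<Phi> (p i)) = ((1 / n) *\<^sub>R mat 1, 0)"
    unfolding q(3)[symmetric] by (rule sum.cong) (simp_all add: p)
  have s1: "(\<Sum>i = 1..k. u i *\<^sub>R outer (fst (p i)) (snd (p i))) = (1 / n) *\<^sub>R mat 1"
    using arg_cong[OF sumPhi, of fst] by (simp add: fst_sum \<Phi>_def)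
  have s2: "(\<Sum>i = 1..k. u i *\<^sub>R snd (p i)) = 0"
    using arg_cong[OF sumPhi, of snd] by (simp add: snd_sum \<Phi>_def)
  show thesis
  proof (rule that[of "{1..k}" "\<lambda>i. n * u i" "\<lambda>i. fst (p i)" "\<lambda>i. snd (p i)"])
    show "(\<Sum>i = 1..k. n * u i) = CARD('n)" 
      unfolding sum_distrib_left[symmetric] q(2) by (simp add: n_def)
    show "(\<Sum>i = 1..k. (n * u i) *\<^sub>R snd (p i)) = 0"
      using s2 by (simp add: scaleR_scaleR[symmetric] scaleR_sum_right[symmetric] del: scaleR_scaleR)
    show "(\<Sum>i = 1..k. (n * u i * (v \<bullet> snd (p i))) *\<^sub>R fst (p i)) = v" for v
    proof (rule vec_eq_iff[THEN iffD2], rule allI)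
      fix j
      have entry: "(\<Sum>i = 1..k. u i * (snd (p i) $ a * fst (p i) $ j)) = (if a = j then 1 / n else 0)" for a
        using arg_cong[OF s1, of "\<lambda>M. M $ a $ j"] by (simp add: outer_def mat_def)
      have "(\<Sum>i = 1..k. (n * u i * (v \<bullet> snd (p i))) *\<^sub>R fst (p i)) $ j =
            (\<Sum>i = 1..k. \<Sum>a\<in>UNIV. n * v $ a * (u i * (snd (p i) $ a * fst (p i) $ j)))"
        by (simp add: inner_vec_def sum_distrib_left sum_distrib_right algebra_simps)
      also have "\<dots> = (\<Sum>a\<in>UNIV. n * v $ a * (\<Sum>i = 1..k. u i * (snd (p i) $ a * fst (p i) $ j)))"
        by (subst sum.swap) (simp add: sum_distrib_left)
      also have "\<dots> = v $ j" unfolding entry using n by (simp add: if_distrib cong: if_cong)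
      finally show "(\<Sum>i = 1..k. (n * u i * (v \<bullet> snd (p i))) *\<^sub>R fst (p i)) $ j = v $ j" .
    qed
  next
    fix i assume i: "i \<in> {1..k}"
    have "p i \<in> C" using p i by blast
    thus "fst (p i) \<in> K" "snd (p i) \<in> polar_body L" "fst (p i) \<bullet> snd (p i) = 1"
      by (auto simp: C_def R_def)
    show "0 \<le> n * u i" using q(1) i n by simp
  qed auto
qed

text \<open>The affine maps carrying \<open>K\<close> into \<open>L\<close> form a compact set: they are parametrised relative to an
interior point \<open>x0\<close> of \<open>K\<close>, so that the translation part is the image of \<open>x0\<close>, and the images of
a small ball around \<open>x0\<close> bound the matrix entries. The determinant is maximised over this set.\<close>

lemma maximal_volume_position:
  fixes K L :: "(real^'n) set"
  assumes K: "convex_body K" and L: "convex_body L"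
  obtains T d where "linear T" "bij T" "(\<lambda>x. T x + d) ` K \<subseteq> L"
    "\<And>A w. (\<And>x. x \<in> (\<lambda>x. T x + d) ` K \<Longrightarrow> A *v x + w \<in> L) \<Longrightarrow> det A \<le> 1"
proof -
  have cL: "compact L" "closed L" using L compact_imp_closed by (auto simp: convex_body_def)
  obtain x0 where "x0 \<in> interior K" using K by (auto simp: convex_body_def)
  then obtain r where r: "0 < r" "cball x0 r \<subseteq> K" using mem_interior_cball by blast
  obtain y0 where "y0 \<in> interior L" using L by (auto simp: convex_body_def)
  then obtain \<rho> where \<rho>: "0 < \<rho>" "cball y0 \<rho> \<subseteq> L" using mem_interior_cball by blast
  have x0: "x0 \<in> K" using r by auto
  obtain R where R: "0 < R" "\<And>x. x \<in> K \<Longrightarrow> norm (x - x0) \<le> R"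
  proof -
    have "bounded ((\<lambda>x. x - x0) ` K)" using K
      by (intro compact_imp_bounded compact_continuous_image continuous_intros) (auto simp: convex_body_def)
    thus ?thesis using that by (auto simp: bounded_pos)
  qed
  obtain Q where Q: "\<And>y. y \<in> L \<Longrightarrow> norm y \<le> Q" using compact_imp_bounded[OF cL(1)] by (auto simp: bounded_iff)
  define S where "S = {p :: (real^'n^'n) \<times> (real^'n). \<forall>x\<in>K. fst p *v (x - x0) + snd p \<in> L}"
  have "closed S"
  proof -
    have "continuous_on UNIV (\<lambda>p :: (real^'n^'n) \<times> (real^'n). fst p *v v + snd p)" for v
    proof -
      have "linear (\<lambda>p :: (real^'n^'n) \<times> (real^'n). fst p *v v + snd p)"
        by (rule linearI) (simp_all add: matrix_vector_mult_add_rdistrib scaleR_matrix_vector_assoc[symmetric] algebra_simps)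
      thus ?thesis by (rule linear_continuous_on[OF linear_conv_bounded_linear[THEN iffD1]])
    qed
    hence "closed ((\<lambda>p :: (real^'n^'n) \<times> (real^'n). fst p *v v + snd p) -` L)" for v
      by (rule closed_vimage[OF cL(2)])
    moreover have "S = (\<Inter>x\<in>K. (\<lambda>p. fst p *v (x - x0) + snd p) -` L)" by (auto simp: S_def)
    ultimately show ?thesis by auto
  qed
  moreover have "bounded S"
  proof (rule boundedI)
    fix p assume p: "p \<in> S"
    obtain A w where Aw: "p = (A, w)" by (cases p)
    have img: "A *v (x - x0) + w \<in> L" if "x \<in> K" for x using p that by (auto simp: S_def Aw)
    have w: "norm w \<le> Q" using Q[OF img[OF x0]] by simp
    have entry: "\<bar>A $ i $ j\<bar> \<le> 2 * Q / r" for i j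
    proof -
      have "x0 + r *\<^sub>R axis j 1 \<in> K" using r by (auto simp: dist_norm)
      from Q[OF img[OF this]] have "norm (r *\<^sub>R (A *v axis j 1) + w) \<le> Q"
        by (simp add: matrix_vector_mult_scaleR)
      hence "norm (r *\<^sub>R (A *v axis j 1)) \<le> 2 * Q" using w norm_triangle_ineq4[of "r *\<^sub>R (A *v axis j 1) + w" w] by simp
      moreover have "\<bar>(r *\<^sub>R (A *v axis j 1)) $ i\<bar> \<le> norm (r *\<^sub>R (A *v axis j (1::real)))" by (rule component_le_norm_cart)
      moreover have "(A *v axis j 1) $ i = A $ i $ j"
        by (simp add: matrix_vector_mult_basis column_def)
      ultimately have "\<bar>r * A $ i $ j\<bar> \<le> 2 * Q" by (simp only: vector_scaleR_component real_scaleR_def)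
      hence "r * \<bar>A $ i $ j\<bar> \<le> 2 * Q" using r by (simp add: abs_mult)
      thus ?thesis using r by (simp add: field_simps)
    qed
    have "norm A \<le> (\<Sum>i\<in>UNIV. norm (A $ i))" unfolding norm_vec_def[of A] by (rule L2_set_le_sum) simp
    also have "\<dots> \<le> (\<Sum>i\<in>UNIV. \<Sum>j\<in>UNIV. \<bar>A $ i $ j\<bar>)" by (intro sum_mono norm_le_l1_cart)
    also have "\<dots> \<le> (\<Sum>i\<in>(UNIV :: 'n set). \<Sum>j\<in>(UNIV :: 'n set). 2 * Q / r)" by (intro sum_mono entry)
    finally have "norm A + norm w \<le> (\<Sum>i\<in>(UNIV :: 'n set). \<Sum>j\<in>(UNIV :: 'n set). 2 * Q / r) + Q" using w by linarith
    thus "norm p \<le> (\<Sum>i\<in>(UNIV :: 'n set). \<Sum>j\<in>(UNIV :: 'n set). 2 * Q / r) + Q"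
      unfolding Aw using norm_Pair_le[of A w] by linarith
  qed
  ultimately have cS: "compact S" using compact_eq_bounded_closed by blast
  have mem0: "(mat (\<rho> / R), y0) \<in> S"
    unfolding S_def
  proof (clarsimp)
    fix x assume x: "x \<in> K"
    have "mat (\<rho> / R) *v (x - x0) = (\<rho> / R) *\<^sub>R (x - x0)"
      by (simp add: vec_eq_iff matrix_vector_mult_def mat_def if_distrib if_distribR cong: if_cong)
    moreover have "norm ((\<rho> / R) *\<^sub>R (x - x0)) \<le> \<rho>"
    proof -
      have "norm ((\<rho> / R) *\<^sub>R (x - x0)) = \<rho> / R * norm (x - x0)" using R(1) \<rho>(1) by simp
      also have "\<dots> \<le> \<rho> / R * R" using R(2)[OF x] R(1) \<rho>(1) by (intro mult_left_mono) auto
      finally show ?thesis using R(1) by simp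
    qed
    ultimately have "mat (\<rho> / R) *v (x - x0) + y0 \<in> cball y0 \<rho>" by (simp add: dist_norm)
    thus "mat (\<rho> / R) *v (x - x0) + y0 \<in> L" using \<rho> by blast
  qed
  have "continuous_on S (\<lambda>p. \<bar>det (fst p)\<bar>)"
    unfolding det_def by (intro continuous_intros)
  then obtain p where p: "p \<in> S" "\<And>q. q \<in> S \<Longrightarrow> \<bar>det (fst q)\<bar> \<le> \<bar>det (fst p)\<bar>"
    using continuous_attains_sup[OF cS, of "\<lambda>p. \<bar>det (fst p)\<bar>"] mem0 by blast
  obtain A w where Aw: "p = (A, w)" by (cases p)
  have "0 < \<bar>det (mat (\<rho> / R) :: real^'n^'n)\<bar>" using \<rho> R 
    by (subst det_diagonal) (auto simp: mat_def)
  hence dA: "det A \<noteq> 0" using p(2)[OF mem0] by (simp add: Aw)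
  have bij: "bij ((*v) A)"
    using dA invertible_eq_bij invertible_det_nz by blast
  show thesis
  proof (rule that[of "(*v) A" "w - A *v x0"])
    show "linear ((*v) A)" "bij ((*v) A)" using bij by auto
    show "(\<lambda>x. A *v x + (w - A *v x0)) ` K \<subseteq> L"
      using p(1) by (auto simp: S_def Aw matrix_vector_mult_diff_distrib algebra_simps)
    fix B u assume B: "\<And>x. x \<in> (\<lambda>x. A *v x + (w - A *v x0)) ` K \<Longrightarrow> B *v x + u \<in> L"
    have "(B ** A, B *v w + u) \<in> S"
      unfolding S_def
    proof clarsimp
      fix x assume "x \<in> K"
      from B[OF imageI[OF this]] show "B ** A *v (x - x0) + (B *v w + u) \<in> L"
        by (simp add: matrix_vector_mul_assoc[symmetric] matrix_vector_mult_diff_distrib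
             matrix_vector_right_distrib algebra_simps)
    qed
    from p(2)[OF this] have "\<bar>det B\<bar> * \<bar>det A\<bar> \<le> \<bar>det A\<bar>" by (simp add: Aw det_mul abs_mult)
    thus "det B \<le> 1" using dA by (simp add: mult_le_cancel_right1)
  qed
qed

section \<open>A dual certificate for a large Gruenbaum distance\<close>

text \<open>Linear programming duality for covering \<open>L\<close> by homothets of \<open>- K\<close>. Here \<open>\<tau>\<close> is the reciprocal of
the ratio that cannot be undercut. If the certificate did not exist, the compact convex hull of
the admissible pairs \<open>(f, a)\<close> could be separated from the ray \<open>{0} \<times> {..\<tau>}\<close>. After normalisation
the separating functional is a vector \<open>w'\<close> and a number \<open>\<kappa> > \<tau>\<close> with \<open>a > \<kappa> + \<langle>w', f\<rangle>\<close> for all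
pairs, and this says that \<open>- w' - \<kappa> L\<close> is contained in \<open>K\<close>. The cap \<open>a \<le> n\<close> makes the set of pairs
compact.\<close>

lemma homothet_certificate:
  fixes K L :: "'a::euclidean_space set"
  assumes K: "compact K" "convex K" "K \<noteq> {}" and L: "compact L" "0 \<in> interior L" and KL: "K \<subseteq> L"
    and asym: "\<And>x f. x \<in> L \<Longrightarrow> f \<in> polar_body L \<Longrightarrow> - n \<le> x \<bullet> f"
    and no_fit: "\<And>w \<kappa>. \<tau> < \<kappa> \<Longrightarrow> \<exists>x\<in>L. - w - \<kappa> *\<^sub>R x \<notin> K" and \<tau>: "0 < \<tau>"
  obtains J :: "nat set" and l a :: "nat \<Rightarrow> real" and f z where
    "finite J" "\<And>j. j \<in> J \<Longrightarrow> 0 \<le> l j" "sum l J = 1" "(\<Sum>j\<in>J. l j *\<^sub>R f j) = 0"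
    "\<And>j. j \<in> J \<Longrightarrow> f j \<in> polar_body L" "\<And>j. j \<in> J \<Longrightarrow> z j \<in> L" "\<And>j. j \<in> J \<Longrightarrow> z j \<bullet> f j = 1"
    "\<And>j. j \<in> J \<Longrightarrow> a j \<le> n" "\<And>j u. j \<in> J \<Longrightarrow> u \<in> K \<Longrightarrow> 0 \<le> u \<bullet> f j + a j"
    "(\<Sum>j\<in>J. l j * a j) \<le> \<tau>"
proof -
  define F where "F = {f \<in> polar_body L. \<exists>z\<in>L. z \<bullet> f = 1}"
  define D where "D = {p. fst p \<in> F \<and> snd p \<le> n \<and> (\<forall>x\<in>K. 0 \<le> x \<bullet> fst p + snd p)}"
  have cF: "compact F"
  proof -
    have "compact ((L \<times> polar_body L) \<inter> {p. fst p \<bullet> snd p = 1})"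
      by (intro compact_Int_closed compact_Times L compact_polar closed_Collect_eq continuous_intros)
    hence "compact (snd ` ((L \<times> polar_body L) \<inter> {p. fst p \<bullet> snd p = 1}))"
      by (intro compact_continuous_image continuous_intros)
    moreover have "snd ` ((L \<times> polar_body L) \<inter> {p. fst p \<bullet> snd p = 1}) = F"
      by (force simp: F_def)
    ultimately show ?thesis by simp
  qed
  have Kn: "0 \<le> x \<bullet> f + n" if "x \<in> K" "f \<in> F" for x f
    using asym[of x f] that KL by (force simp: F_def)
  have topD: "(f, n) \<in> D" if "f \<in> F" for f using that Kn by (auto simp: D_def)
  obtain x0 where x0: "x0 \<in> K" using K by blast
  have low: "- 1 \<le> snd p" if "p \<in> D" for p
  proof -
    have "x0 \<bullet> fst p \<le> 1" using that x0 KL by (auto simp: D_def F_def polar_body_def inner_commute)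
    thus ?thesis using that x0 by (force simp: D_def)
  qed
  have D_eq: "D = (F \<times> {- 1..n}) \<inter> (\<Inter>x\<in>K. {p. 0 \<le> x \<bullet> fst p + snd p})"
    using low by (auto simp: D_def)
  have "closed (\<Inter>x\<in>K. {p :: 'a \<times> real. 0 \<le> x \<bullet> fst p + snd p})"
    by (intro closed_INT ballI closed_Collect_le continuous_intros)
  hence cD: "compact D"
    unfolding D_eq by (rule compact_Int_closed[OF compact_Times[OF cF compact_Icc]])
  hence cH: "compact (convex hull D)" by (rule compact_convex_hull)
  define Z where "Z = {p :: 'a \<times> real. fst p = 0 \<and> snd p \<le> \<tau>}"
  have Z: "Z = {0} \<times> {..\<tau>}" by (auto simp: Z_def)
  have "convex hull D \<inter> Z \<noteq> {}"
  proof
    assume disj: "convex hull D \<inter> Z = {}"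
    obtain e :: 'a where "e \<noteq> 0" using nonzero_Basis nonempty_Basis by blast
    then obtain h z where "(1 / h) *\<^sub>R e \<in> polar_body L" "z \<in> L" "z \<bullet> (1 / h) *\<^sub>R e = 1"
      by (rule supporting_functional[OF L])
    then obtain f0 where f0: "f0 \<in> F" unfolding F_def by blast
    have ne: "convex hull D \<noteq> {}" using topD[OF f0] by auto
    have "convex Z" "closed Z" unfolding Z by (auto intro!: convex_Times closed_Times)
    then obtain q b where q: "\<forall>p\<in>convex hull D. q \<bullet> p < b" "\<forall>p\<in>Z. b < q \<bullet> p"
      using separating_hyperplane_compact_closed[OF convex_convex_hull cH ne _ _ disj] by blast
    obtain w \<sigma> where ws: "q = (w, \<sigma>)" by (cases q)
    have 1: "w \<bullet> f + \<sigma> * a < b" if "(f, a) \<in> D" for f a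
      using q(1) hull_inc[OF that] by (force simp: ws)
    have 2: "b < \<sigma> * \<theta>" if "\<theta> \<le> \<tau>" for \<theta>
    proof -
      have "(0, \<theta>) \<in> Z" using that by (simp add: Z_def)
      thus ?thesis using q(2) by (force simp: ws)
    qed
    have "\<sigma> \<le> 0"
    proof (rule ccontr)
      assume s: "\<not> \<sigma> \<le> 0"
      \<comment> \<open>the ray is unbounded below, so its functional cannot have a positive slope\<close>
      have "b < \<sigma> * min \<tau> (b / \<sigma>)" by (rule 2) simp
      also have "\<dots> \<le> \<sigma> * (b / \<sigma>)" using s by (intro mult_left_mono) auto
      also have "\<dots> = b" using s by simp
      finally show False by simp
    qed
    moreover have "\<sigma> \<noteq> 0"
    proof
      assume s: "\<sigma> = 0"
      have b: "b < 0" using 2[of 0] s \<tau> by simp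
      have "w \<noteq> 0" using 1[OF topD[OF f0]] s b by auto
      then obtain h z where h: "0 < h" "(1 / h) *\<^sub>R w \<in> polar_body L" "z \<in> L" "z \<bullet> (1 / h) *\<^sub>R w = 1"
        by (rule supporting_functional[OF L])
      hence "(1 / h) *\<^sub>R w \<in> F" by (auto simp: F_def)
      from 1[OF topD[OF this]] have "w \<bullet> (1 / h) *\<^sub>R w < 0" using s b by simp
      moreover have "0 \<le> w \<bullet> (1 / h) *\<^sub>R w" using h(1) by simp
      ultimately show False by simp
    qed
    ultimately have s: "\<sigma> < 0" by simp
    \<comment> \<open>division by the negative number \<open>\<sigma>\<close> turns the separating functional into a homothet of \<open>L\<close> inside \<open>K\<close>\<close>
    define \<kappa> where "\<kappa> = b / \<sigma>"
    define w' where "w' = (- 1 / \<sigma>) *\<^sub>R w"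
    have \<kappa>: "\<tau> < \<kappa>" using 2[of \<tau>] s by (simp add: \<kappa>_def field_simps)
    have 3: "\<kappa> + w' \<bullet> f < a" if "(f, a) \<in> D" for f a
      using 1[OF that] s by (simp add: \<kappa>_def w'_def field_simps)
    obtain x where x: "x \<in> L" "- w' - \<kappa> *\<^sub>R x \<notin> K" using no_fit[OF \<kappa>] by blast
    define z where "z = - w' - \<kappa> *\<^sub>R x"
    obtain g c where g: "g \<bullet> z < c" "\<And>y. y \<in> K \<Longrightarrow> c < g \<bullet> y"
      using separating_hyperplane_closed_point[OF K(2) compact_imp_closed[OF K(1)]] x(2) unfolding z_def by blast
    have "g \<noteq> 0" using g(1) g(2)[OF x0] by auto
    then obtain h y where h: "0 < h" "(1 / h) *\<^sub>R g \<in> polar_body L" "y \<in> L" "y \<bullet> (1 / h) *\<^sub>R g = 1"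
      by (rule supporting_functional[OF L])
    define f where "f = (1 / h) *\<^sub>R g"
    \<comment> \<open>capping at \<open>n\<close> keeps the half-space valid on \<open>K\<close>, because \<open>L\<close> itself satisfies it\<close>
    define a where "a = min (- c / h) n"
    have f: "f \<in> F" "f \<in> polar_body L" using h by (auto simp: F_def f_def)
    have "(f, a) \<in> D"
    proof -
      have "0 \<le> y \<bullet> f + a" if "y \<in> K" for y
      proof -
        have "0 \<le> y \<bullet> f + - c / h" using g(2)[OF that] h(1) by (simp add: f_def inner_commute field_simps)
        thus ?thesis using Kn[OF that f(1)] by (auto simp: a_def min_def)
      qed
      thus ?thesis using f by (auto simp: D_def a_def)
    qed
    from 3[OF this] have "\<kappa> + w' \<bullet> f < - c / h" by (simp add: a_def)
    also have "\<dots> < - (z \<bullet> f)" using g(1) h(1) by (simp add: f_def inner_commute field_simps)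
    also have "\<dots> = w' \<bullet> f + \<kappa> * (x \<bullet> f)" by (simp add: z_def inner_diff_left)
    also have "\<dots> \<le> w' \<bullet> f + \<kappa> * 1"
      using f(2) x(1) \<kappa> \<tau> by (intro add_left_mono mult_left_mono) (auto simp: polar_body_def inner_commute)
    finally show False by simp
  qed
  then obtain p where p: "p \<in> convex hull D" "p \<in> Z" by blast
  then obtain k u q where q: "\<forall>i\<in>{1::nat..k}. 0 \<le> u i \<and> q i \<in> D" "sum u {1..k} = 1"
    "(\<Sum>i = 1..k. u i *\<^sub>R q i) = p"
    unfolding convex_hull_indexed by blast
  have "\<exists>z. z \<in> L \<and> z \<bullet> fst (q j) = 1" if "j \<in> {1..k}" for j using q(1) that by (force simp: D_def F_def)
  then obtain z where z: "\<And>j. j \<in> {1..k} \<Longrightarrow> z j \<in> L \<and> z j \<bullet> fst (q j) = 1" by metis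
  show thesis
  proof (rule that[of "{1..k}" u "\<lambda>i. fst (q i)" z "\<lambda>i. snd (q i)"])
    show "(\<Sum>j = 1..k. u j *\<^sub>R fst (q j)) = 0"
      using arg_cong[OF q(3), of fst] p(2) by (simp add: fst_sum Z_def)
    show "(\<Sum>j = 1..k. u j * snd (q j)) \<le> \<tau>"
      using arg_cong[OF q(3), of snd] p(2) by (simp add: snd_sum Z_def)
    show "sum u {1..k} = 1" by fact
    fix j assume j: "j \<in> {1..k}"
    hence "q j \<in> D" using q by blast
    thus "fst (q j) \<in> polar_body L" "snd (q j) \<le> n" "\<And>v. v \<in> K \<Longrightarrow> 0 \<le> v \<bullet> fst (q j) + snd (q j)"
      by (auto simp: D_def F_def)
    show "0 \<le> u j" using q(1) j by blast
    show "z j \<in> L" "z j \<bullet> fst (q j) = 1" using z j by auto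
  qed auto
qed

text \<open>An inclusion \<open>- w - \<kappa> L \<subseteq> K\<close> for a position \<open>K \<subseteq> L\<close> would give ratio \<open>- 1 / \<kappa>\<close>; the translation by
\<open>w / (1 + \<kappa>)\<close> moves the centre of the homothety to the origin.\<close>

lemma grunbaum_no_fit:
  fixes K L :: "'a::euclidean_space set"
  assumes T: "linear T" "bij T" and KL: "(\<lambda>x. T x + d) ` K \<subseteq> L"
    and far: "1 / \<tau> \<le> grunbaum_dist K L" and \<tau>: "0 < \<tau>" "\<tau> < \<kappa>"
  shows "\<exists>x\<in>L. - w - \<kappa> *\<^sub>R x \<notin> (\<lambda>x. T x + d) ` K"
proof (rule ccontr)
  assume "\<not> ?thesis"
  hence fit: "- w - \<kappa> *\<^sub>R x \<in> (\<lambda>x. T x + d) ` K" if "x \<in> L" for x using that by blast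
  define u where "u = (1 / (1 + \<kappa>)) *\<^sub>R w"
  have k: "0 < \<kappa>" using \<tau> by simp
  have eq: "x + u = (- 1 / \<kappa>) *\<^sub>R ((- w - \<kappa> *\<^sub>R x) + u)" for x
  proof -
    have "(1 + \<kappa>) *\<^sub>R u = w" using k by (simp add: u_def)
    hence w: "w = u + \<kappa> *\<^sub>R u" by (simp add: algebra_simps)
    show ?thesis unfolding w using k by (simp add: algebra_simps)
  qed
  have "sandwiched ((\<lambda>x. T x + d) ` K) L (- 1 / \<kappa>)"
    unfolding sandwiched_def
  proof (intro exI conjI)
    show "linear id" "bij id" by (auto simp: linear_id)
    show "(\<lambda>x. x + u) ` (\<lambda>x. T x + d) ` K \<subseteq> id ` (\<lambda>x. x + u) ` L" using KL by auto
    show "id ` (\<lambda>x. x + u) ` L \<subseteq> (*\<^sub>R) (- 1 / \<kappa>) ` (\<lambda>x. x + u) ` (\<lambda>x. T x + d) ` K"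
    proof
      fix y assume "y \<in> id ` (\<lambda>x. x + u) ` L"
      then obtain x where "x \<in> L" "y = x + u" by auto
      thus "y \<in> (*\<^sub>R) (- 1 / \<kappa>) ` (\<lambda>x. x + u) ` (\<lambda>x. T x + d) ` K"
        using eq[of x] fit[of x] by blast
    qed
  qed
  from grunbaum_dist_le[OF sandwiched_affine_image_left[OF T this]]
  have "1 / \<tau> \<le> 1 / \<kappa>" using far k by simp
  thus False using \<tau> k by (simp add: field_simps)
qed

section \<open>Clustering of contact points\<close>

text \<open>Distance at most \<open>s\<close> in the supremum norm over \<open>L\<close>, which is the symmetrised gauge of the polar
body.\<close>

definition near :: "'a::euclidean_space set \<Rightarrow> real \<Rightarrow> 'a \<Rightarrow> 'a \<Rightarrow> bool" where
  "near L s u v \<longleftrightarrow> (\<forall>w\<in>L. \<bar>w \<bullet> u - w \<bullet> v\<bar> \<le> s)"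

lemma near_sym: "near L s u v \<Longrightarrow> near L s v u"
  by (auto simp: near_def abs_minus_commute)

lemma near_trans:
  assumes "near L s u v" "near L s' v w" shows "near L (s + s') u w"
  unfolding near_def
proof
  fix q assume "q \<in> L"
  hence "\<bar>q \<bullet> u - q \<bullet> v\<bar> \<le> s" "\<bar>q \<bullet> v - q \<bullet> w\<bar> \<le> s'" using assms by (auto simp: near_def)
  thus "\<bar>q \<bullet> u - q \<bullet> w\<bar> \<le> s + s'" by linarith
qed

text \<open>The data produced by the two duality arguments. The contact points \<open>x i\<close>, their normals \<open>y i\<close> and
the weights \<open>c i\<close> decompose the identity; the functionals \<open>f j\<close>, their points of contact \<open>z j\<close>, the
half-space constants \<open>a j\<close> and the weights \<open>l j\<close> certify the large distance, with
\<open>e = \<epsilon> / (1 - \<epsilon>)\<close>. The assumption \<open>close\<close> is the only form in which the shape of \<open>L\<close> enters: a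
normal that is \<open>\<eta>\<close>-close to supporting \<open>L\<close> at \<open>z j\<close> is \<open>t\<close>-near to \<open>f j\<close>. The number \<open>\<beta>\<close> bounds
\<open>e / \<eta>\<close>, the total weight that the pairs that are not near can carry.\<close>

locale contact_system =
  fixes L :: "'a::euclidean_space set" and N :: nat and n t \<eta> \<beta> e :: real
    and I :: "'i set" and c :: "'i \<Rightarrow> real" and x y :: "'i \<Rightarrow> 'a"
    and J :: "'j set" and l a :: "'j \<Rightarrow> real" and f z :: "'j \<Rightarrow> 'a"
  assumes finI: "finite I" and finJ: "finite J"
    and n_def: "n = real N" and n2: "n \<ge> 2"
    and c0: "\<And>i. i \<in> I \<Longrightarrow> 0 \<le> c i" and csum: "sum c I = n"
    and xL: "\<And>i. i \<in> I \<Longrightarrow> x i \<in> L"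
    and xy: "\<And>i. i \<in> I \<Longrightarrow> x i \<bullet> y i = 1"
    and yL: "\<And>i w. i \<in> I \<Longrightarrow> w \<in> L \<Longrightarrow> w \<bullet> y i \<le> 1"
    and resolution: "\<And>u. (\<Sum>i\<in>I. (c i * (u \<bullet> y i)) *\<^sub>R x i) = u"
    and ybal: "(\<Sum>i\<in>I. c i *\<^sub>R y i) = 0"
    and l0: "\<And>j. j \<in> J \<Longrightarrow> 0 \<le> l j" and lsum: "sum l J = 1"
    and fbal: "(\<Sum>j\<in>J. l j *\<^sub>R f j) = 0"
    and fL: "\<And>j w. j \<in> J \<Longrightarrow> w \<in> L \<Longrightarrow> w \<bullet> f j \<le> 1"
    and zL: "\<And>j. j \<in> J \<Longrightarrow> z j \<in> L"
    and zf: "\<And>j. j \<in> J \<Longrightarrow> z j \<bullet> f j = 1"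
    and an: "\<And>j. j \<in> J \<Longrightarrow> a j \<le> n"
    and g0: "\<And>i j. i \<in> I \<Longrightarrow> j \<in> J \<Longrightarrow> 0 \<le> x i \<bullet> f j + a j"
    and asum: "(\<Sum>j\<in>J. l j * a j) \<le> (1 + e) / n"
    and close: "\<And>i j. i \<in> I \<Longrightarrow> j \<in> J \<Longrightarrow> 1 - \<eta> < z j \<bullet> y i \<Longrightarrow> near L t (y i) (f j)"
    and eta: "0 < \<eta>" and e0: "0 \<le> e" and e1: "e \<le> \<beta> * \<eta>" and e2: "e \<le> \<beta>"
    and beta: "\<beta> \<le> 1 / (64 * n ^ 4)" and t0: "0 \<le> t" and t1: "t \<le> 1 / (20 * n\<^sup>2)"
begin

text \<open>The number \<open>g i j\<close> is the slack of the contact point \<open>x i\<close> in the half-space of \<open>f j\<close>, and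
\<open>Gfar j\<close> and \<open>Ffar i\<close> collect the slack over the pairs that are not near. The weight \<open>mu\<close> is the
one for which every cluster of functionals has mass about \<open>1 / n\<close>.\<close>

definition g :: "'i \<Rightarrow> 'j \<Rightarrow> real" where "g i j = x i \<bullet> f j + a j"
definition adj :: "'i \<Rightarrow> 'j \<Rightarrow> bool" where "adj i j \<longleftrightarrow> near L t (y i) (f j)"
definition abar :: real where "abar = (\<Sum>j\<in>J. l j * a j)"
definition Jof :: "'i \<Rightarrow> 'j set" where "Jof i = {j\<in>J. adj i j}"
definition Iof :: "'j \<Rightarrow> 'i set" where "Iof j = {i\<in>I. adj i j}"
definition Gfar :: "'j \<Rightarrow> real" where "Gfar j = (\<Sum>i\<in>I - Iof j. c i * g i j)"
definition Ffar :: "'i \<Rightarrow> real" where "Ffar i = (\<Sum>j\<in>J - Jof i. l j * g i j)"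
definition good :: "'i set" where "good = {i\<in>I. Ffar i \<le> 1 / (4 * n\<^sup>2)}"
definition mu :: "'j set \<Rightarrow> real" where "mu A = (\<Sum>j\<in>A. l j * (1 + a j))"

lemma g_nonneg: "i \<in> I \<Longrightarrow> j \<in> J \<Longrightarrow> 0 \<le> g i j"
  using g0 by (simp add: g_def)

lemma g_le: "i \<in> I \<Longrightarrow> j \<in> J \<Longrightarrow> g i j \<le> 1 + a j"
  using fL[OF _ xL, of j i] by (simp add: g_def)

lemma g_near: "i \<in> I \<Longrightarrow> near L s (y i) (f j) \<Longrightarrow> 1 + a j - s \<le> g i j"
  using xL[of i] xy[of i] by (force simp: g_def near_def)

lemma n_pos: "0 < n" using n2 by simp

lemma beta0: "0 \<le> \<beta>" using e0 e2 by linarith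

text \<open>The average of the functionals vanishes, so the average of the half-space functions is a constant
function.\<close>

lemma weighted_g: 
  assumes "i \<in> I" shows "(\<Sum>j\<in>J. l j * g i j) = abar"
proof -
  have "(\<Sum>j\<in>J. l j * g i j) = x i \<bullet> (\<Sum>j\<in>J. l j *\<^sub>R f j) + abar"
    by (simp add: g_def abar_def inner_sum_right distrib_left sum.distrib)
  thus ?thesis by (simp add: fbal)
qed

text \<open>The decomposition of the identity evaluated at \<open>z j\<close> and \<open>f j\<close>; since the normals \<open>y i\<close> balance, the
constants \<open>a j\<close> can be inserted for free.\<close>

lemma resolution_f:
  assumes j: "j \<in> J" shows "(\<Sum>i\<in>I. c i * g i j * (z j \<bullet> y i)) = 1"
proof -
  have "1 = (\<Sum>i\<in>I. (c i * (z j \<bullet> y i)) *\<^sub>R x i) \<bullet> f j"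
    using resolution[of "z j"] zf[OF j] by simp
  also have "\<dots> = (\<Sum>i\<in>I. c i * (z j \<bullet> y i) * (x i \<bullet> f j))"
    by (simp add: inner_sum_left)
  finally have 1: "(\<Sum>i\<in>I. c i * (z j \<bullet> y i) * (x i \<bullet> f j)) = 1" by simp
  have "z j \<bullet> (\<Sum>i\<in>I. c i *\<^sub>R y i) = 0" by (simp add: ybal)
  hence "(\<Sum>i\<in>I. c i * (z j \<bullet> y i)) = 0" by (simp add: inner_sum_right)
  hence 2: "a j * (\<Sum>i\<in>I. c i * (z j \<bullet> y i)) = 0" by simp
  have "(\<Sum>i\<in>I. c i * g i j * (z j \<bullet> y i)) = 
     (\<Sum>i\<in>I. c i * (z j \<bullet> y i) * (x i \<bullet> f j)) + a j * (\<Sum>i\<in>I. c i * (z j \<bullet> y i))"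
    by (simp add: g_def sum_distrib_left sum.distrib algebra_simps)
  with 1 2 show ?thesis by simp
qed

text \<open>The central identity: the right-hand side is nonnegative because all terms on the left are, and it
is at most \<open>e\<close> by the certificate.\<close>

lemma defect_identity:
  "(\<Sum>j\<in>J. \<Sum>i\<in>I. l j * c i * g i j * (1 - z j \<bullet> y i)) = n * abar - 1"
proof -
  have "(\<Sum>j\<in>J. \<Sum>i\<in>I. l j * c i * g i j * (1 - z j \<bullet> y i)) =
        (\<Sum>j\<in>J. \<Sum>i\<in>I. l j * c i * g i j) - (\<Sum>j\<in>J. l j * (\<Sum>i\<in>I. c i * g i j * (z j \<bullet> y i)))"
    by (simp add: algebra_simps sum_subtractf sum_distrib_left)
  also have "(\<Sum>j\<in>J. l j * (\<Sum>i\<in>I. c i * g i j * (z j \<bullet> y i))) = 1"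
    using lsum resolution_f by (simp cong: sum.cong)
  also have "(\<Sum>j\<in>J. \<Sum>i\<in>I. l j * c i * g i j) = (\<Sum>i\<in>I. c i * (\<Sum>j\<in>J. l j * g i j))"
    by (subst sum.swap) (simp add: sum_distrib_left algebra_simps)
  also have "\<dots> = (\<Sum>i\<in>I. c i * abar)"
    by (rule sum.cong) (auto simp: weighted_g)
  also have "\<dots> = n * abar" by (simp add: csum sum_distrib_right[symmetric])
  finally show ?thesis .
qed

lemma defect_term: "i \<in> I \<Longrightarrow> j \<in> J \<Longrightarrow> 0 \<le> l j * c i * g i j * (1 - z j \<bullet> y i)"
  using yL[OF _ zL] by (simp add: l0 c0 g_nonneg)

lemma abar_ge: "1 / n \<le> abar"
proof -
  have "0 \<le> n * abar - 1"
    unfolding defect_identity[symmetric] by (intro sum_nonneg defect_term)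
  thus ?thesis using n_pos by (simp add: field_simps)
qed

lemma abar_le: "n * abar \<le> 1 + e"
  using asum n_pos by (simp add: abar_def field_simps)

lemma far_term:
  assumes "i \<in> I" "j \<in> J" "\<not> adj i j"
  shows "l j * c i * g i j * \<eta> \<le> l j * c i * g i j * (1 - z j \<bullet> y i)"
proof (rule mult_left_mono)
  show "\<eta> \<le> 1 - z j \<bullet> y i" using close[OF assms(1,2)] assms(3) by (force simp: adj_def)
  show "0 \<le> l j * c i * g i j" using assms by (simp add: l0 c0 g_nonneg)
qed

lemma sum_Gfar: "(\<Sum>j\<in>J. l j * Gfar j) \<le> \<beta>"
proof -
  have "(\<Sum>j\<in>J. l j * Gfar j) * \<eta> = (\<Sum>j\<in>J. \<Sum>i\<in>I - Iof j. l j * c i * g i j * \<eta>)"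
    by (simp add: Gfar_def sum_distrib_left sum_distrib_right algebra_simps)
  also have "\<dots> \<le> (\<Sum>j\<in>J. \<Sum>i\<in>I - Iof j. l j * c i * g i j * (1 - z j \<bullet> y i))"
    by (intro sum_mono far_term) (auto simp: Iof_def)
  also have "\<dots> \<le> (\<Sum>j\<in>J. \<Sum>i\<in>I. l j * c i * g i j * (1 - z j \<bullet> y i))"
    by (intro sum_mono sum_mono2 defect_term) (auto simp: finI)
  also have "\<dots> \<le> \<beta> * \<eta>" unfolding defect_identity using abar_le e1 by linarith
  finally show ?thesis using eta by simp
qed

lemma sum_Ffar: "(\<Sum>i\<in>I. c i * Ffar i) \<le> \<beta>"
proof -
  have "(\<Sum>i\<in>I. c i * Ffar i) = (\<Sum>i\<in>I. \<Sum>j\<in>J. if adj i j then 0 else c i * l j * g i j)"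
    unfolding Ffar_def sum_distrib_left
    by (intro sum.cong sum.mono_neutral_cong_left) (auto simp: finJ Jof_def)
  also have "\<dots> = (\<Sum>j\<in>J. \<Sum>i\<in>I. if adj i j then 0 else c i * l j * g i j)"
    by (rule sum.swap)
  also have "\<dots> = (\<Sum>j\<in>J. l j * Gfar j)"
    unfolding Gfar_def sum_distrib_left
    by (intro sum.cong sum.mono_neutral_cong_right) (auto simp: finI Iof_def)
  finally show ?thesis using sum_Gfar by simp
qed

lemma Gfar_nonneg: "j \<in> J \<Longrightarrow> 0 \<le> Gfar j"
  unfolding Gfar_def by (intro sum_nonneg) (auto simp: c0 g_nonneg)

lemma Ffar_nonneg: "i \<in> I \<Longrightarrow> 0 \<le> Ffar i"
  unfolding Ffar_def by (intro sum_nonneg) (auto simp: l0 g_nonneg)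

lemma a_ge:
  assumes "j \<in> J" shows "0 \<le> 1 + a j"
proof -
  have "I \<noteq> {}" using csum n_pos by auto
  then obtain i where "i \<in> I" by auto
  thus ?thesis using g_le g_nonneg assms order_trans by blast
qed

lemma mu_le: 
  assumes "A \<subseteq> J" shows "mu A \<le> (1 + n) * sum l A"
proof -
  have "mu A \<le> (\<Sum>j\<in>A. l j * (1 + n))"
    unfolding mu_def using assms an l0 by (intro sum_mono mult_left_mono) auto
  thus ?thesis by (simp add: sum_distrib_right[symmetric] mult.commute)
qed

lemma mu_total: "mu J = 1 + abar"
  by (simp add: mu_def abar_def distrib_left sum.distrib lsum)

text \<open>Each cluster of functionals around a good normal carries almost the whole average \<open>abar\<close>, which is
at least \<open>1 / n\<close>.\<close>

lemma mu_Jof_ge: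
  assumes i: "i \<in> good" shows "7 / (8 * n) \<le> mu (Jof i)"
proof -
  have iI: "i \<in> I" using i by (simp add: good_def)
  have sub: "Jof i \<subseteq> J" by (auto simp: Jof_def)
  have "abar = (\<Sum>j\<in>Jof i. l j * g i j) + Ffar i"
    unfolding Ffar_def weighted_g[OF iI, symmetric]
    using sum.subset_diff[OF sub finJ, of "\<lambda>j. l j * g i j"] by simp
  also have "(\<Sum>j\<in>Jof i. l j * g i j) \<le> mu (Jof i)"
    unfolding mu_def using sub iI by (intro sum_mono mult_left_mono g_le l0) auto
  finally have "abar \<le> mu (Jof i) + 1 / (4 * n\<^sup>2)" using i by (simp add: good_def)
  moreover have "1 / (4 * n\<^sup>2) \<le> 1 / (8 * n)" 
    using n2 by (simp add: field_simps power2_eq_square)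
  moreover have "1 / n = 7 / (8 * n) + 1 / (8 * n)" using n_pos by (simp add: field_simps)
  ultimately show ?thesis using abar_ge by linarith
qed

text \<open>Conversely, functionals that are all near one normal cannot carry much more than \<open>abar\<close>.\<close>

lemma mu_near_le:
  assumes i: "i \<in> I" and A: "A \<subseteq> J" and nr: "\<And>j. j \<in> A \<Longrightarrow> near L s (y i) (f j)" and s: "0 \<le> s"
  shows "mu A \<le> abar + s"
proof -
  have "mu A - s * sum l A = (\<Sum>j\<in>A. l j * (1 + a j - s))"
    by (simp add: mu_def sum_distrib_left algebra_simps sum_subtractf sum.distrib)
  also have "\<dots> \<le> (\<Sum>j\<in>A. l j * g i j)"
    using A i nr by (intro sum_mono mult_left_mono g_near l0) auto
  also have "\<dots> \<le> (\<Sum>j\<in>J. l j * g i j)"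
    using A i by (intro sum_mono2) (auto simp: finJ l0 g_nonneg)
  also have "\<dots> = abar" by (rule weighted_g[OF i])
  finally have "mu A \<le> abar + s * sum l A" by simp
  moreover have "sum l A \<le> 1"
    unfolding lsum[symmetric] using A by (intro sum_mono2) (auto simp: finJ l0)
  ultimately show ?thesis using s mult_left_le[of "sum l A" s] by linarith
qed

text \<open>Bounding \<open>\<langle>z j, y i\<rangle>\<close> by one in \<open>resolution_f\<close> shows that if \<open>Gfar j\<close> is not large, a definite mass
of contact normals is near \<open>f j\<close>.\<close>

lemma Iof_mass:
  assumes j: "j \<in> J" shows "1 - Gfar j \<le> (1 + a j) * sum c (Iof j)"
proof -
  have sub: "Iof j \<subseteq> I" by (auto simp: Iof_def)
  have "1 \<le> (\<Sum>i\<in>I. c i * g i j)"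
    unfolding resolution_f[OF j, symmetric] 
  proof (rule sum_mono)
    fix i assume i: "i \<in> I"
    show "c i * g i j * (z j \<bullet> y i) \<le> c i * g i j"
      using yL[OF i zL[OF j]] i j by (intro mult_right_le_one_le mult_left_le) (auto simp: c0 g_nonneg)
  qed
  also have "\<dots> = (\<Sum>i\<in>Iof j. c i * g i j) + Gfar j"
    unfolding Gfar_def using sum.subset_diff[OF sub finI, of "\<lambda>i. c i * g i j"] by simp
  also have "(\<Sum>i\<in>Iof j. c i * g i j) \<le> (\<Sum>i\<in>Iof j. c i * (1 + a j))"
    using sub j by (intro sum_mono mult_left_mono g_le c0) auto
  finally show ?thesis by (simp add: sum_distrib_left mult.commute)
qed

text \<open>Markov's inequality for \<open>Ffar\<close>.\<close>

lemma bad_mass: "sum c (I - good) \<le> 4 * n\<^sup>2 * \<beta>"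
proof -
  have "sum c (I - good) * (1 / (4 * n\<^sup>2)) = (\<Sum>i\<in>I - good. c i * (1 / (4 * n\<^sup>2)))"
    by (rule sum_distrib_right)
  also have "\<dots> \<le> (\<Sum>i\<in>I - good. c i * Ffar i)"
    by (intro sum_mono mult_left_mono) (auto simp: good_def c0)
  also have "\<dots> \<le> (\<Sum>i\<in>I. c i * Ffar i)"
    by (intro sum_mono2) (auto simp: finI c0 Ffar_nonneg)
  also have "\<dots> \<le> \<beta>" by (rule sum_Ffar)
  finally show ?thesis using n_pos by (simp add: field_simps)
qed

lemma markov_Gfar:
  assumes "A \<subseteq> J" "\<And>j. j \<in> A \<Longrightarrow> 1/2 \<le> Gfar j"
  shows "sum l A \<le> 2 * \<beta>"
proof -
  have "sum l A * (1/2) = (\<Sum>j\<in>A. l j * (1/2))" by (simp add: sum_distrib_right)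
  also have "\<dots> \<le> (\<Sum>j\<in>A. l j * Gfar j)"
    using assms by (intro sum_mono mult_left_mono l0) auto
  also have "\<dots> \<le> (\<Sum>j\<in>J. l j * Gfar j)"
    using assms by (intro sum_mono2) (auto simp: finJ l0 Gfar_nonneg)
  finally show ?thesis using sum_Gfar by simp
qed

lemma beta_times_cube: "4 * n\<^sup>2 * \<beta> * (1 + n) \<le> 1/2"
proof -
  have "4 * n\<^sup>2 * \<beta> * (1 + n) \<le> 4 * n\<^sup>2 * (1 / (64 * n ^ 4)) * (1 + n)"
    using beta n_pos by (intro mult_right_mono mult_left_mono) auto
  also have "\<dots> = (1 + n) / (16 * n\<^sup>2)" using n_pos by (simp add: field_simps power_def)
  also have "\<dots> \<le> 1/2" 
  proof -
    have "2 * n \<le> n\<^sup>2" using n2 by (simp add: power2_eq_square)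
    thus ?thesis using n2 by (simp add: field_simps)
  qed
  finally show ?thesis .
qed

text \<open>A functional that is near no good normal has only bad ones in its neighbourhood, hence little
mass there; by \<open>Iof_mass\<close> its \<open>Gfar\<close> is large, and this is rare.\<close>

lemma orphan_mass:
  assumes A: "A \<subseteq> J" and orphan: "\<And>j i. j \<in> A \<Longrightarrow> i \<in> good \<Longrightarrow> \<not> adj i j"
  shows "mu A \<le> 2 * (1 + n) * \<beta>"
proof -
  have "1/2 \<le> Gfar j" if j: "j \<in> A" for j
  proof -
    have jJ: "j \<in> J" using j A by auto
    have "sum c (Iof j) \<le> sum c (I - good)"
      using orphan[OF j] by (intro sum_mono2) (auto simp: finI c0 Iof_def)
    with bad_mass have "sum c (Iof j) \<le> 4 * n\<^sup>2 * \<beta>" by linarith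
    hence "(1 + a j) * sum c (Iof j) \<le> (1 + n) * (4 * n\<^sup>2 * \<beta>)"
      using an[OF jJ] a_ge[OF jJ] n_pos by (intro mult_mono) (auto intro!: sum_nonneg c0 simp: Iof_def)
    with beta_times_cube Iof_mass[OF jJ] show ?thesis by (simp add: mult.commute)
  qed
  with markov_Gfar[OF A] have "sum l A \<le> 2 * \<beta>" by blast
  hence "(1 + n) * sum l A \<le> (1 + n) * (2 * \<beta>)" using n_pos by (intro mult_left_mono) auto
  with mu_le[OF A] show ?thesis by (simp add: mult.commute mult.left_commute)
qed

lemma orphan_mass_small: "2 * (1 + n) * \<beta> \<le> 1 / (8 * n)"
proof -
  have "\<beta> * (4 * n\<^sup>2 * (1 + n)) \<le> 1/2" using beta_times_cube by (simp add: algebra_simps)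
  hence "(2 * (1 + n) * \<beta>) * (2 * n\<^sup>2) \<le> 1/2" by (simp add: algebra_simps)
  hence "2 * (1 + n) * \<beta> \<le> 1 / (4 * n\<^sup>2)" using n_pos by (simp add: field_simps)
  also have "\<dots> \<le> 1 / (8 * n)" using n2 by (simp add: field_simps power2_eq_square)
  finally show ?thesis .
qed

lemma slack: "e + 5 * n * t + 2 * (1 + n) * \<beta> < 1 / n"
proof -
  have "5 * n * t \<le> 5 * n * (1 / (20 * n\<^sup>2))" using t1 n_pos by (intro mult_left_mono) auto
  also have "\<dots> = 1 / (4 * n)" using n_pos by (simp add: field_simps power2_eq_square)
  finally have 1: "5 * n * t \<le> 1 / (4 * n)" .
  have "e \<le> 2 * (1 + n) * \<beta>" using beta0 n_pos by (intro order_trans[OF e2]) (simp add: algebra_simps)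
  hence "e + 5 * n * t + 2 * (1 + n) * \<beta> \<le> 1 / (8 * n) + 1 / (4 * n) + 1 / (8 * n)" 
    using 1 orphan_mass_small add_mono[OF add_mono[of e "1 / (8 * n)", OF _ 1] orphan_mass_small] by (simp only: order_trans)
  also have "\<dots> < 1 / n" using n_pos by (simp add: field_simps)
  finally show ?thesis .
qed

text \<open>Take a maximal \<open>4 t\<close>-separated family of good normals. The functionals within \<open>5 t\<close> of its members
exhaust the total mass \<open>1 + abar\<close> up to the orphans, and each member accounts for at most
\<open>abar + 5 t\<close>. With only \<open>n\<close> members this would give \<open>1 + abar\<close> at most
\<open>n abar + small = 1 + small\<close>, contradicting \<open>abar \<ge> 1 / n\<close>.\<close>

lemma separated_family:
  obtains P where "P \<subseteq> good" "card P = N + 1"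
    "\<And>i k. i \<in> P \<Longrightarrow> k \<in> P \<Longrightarrow> i \<noteq> k \<Longrightarrow> \<not> near L (4 * t) (y i) (y k)"
proof -
  define sep where "sep P \<longleftrightarrow> P \<subseteq> good \<and> 
     (\<forall>i\<in>P. \<forall>k\<in>P. i \<noteq> k \<longrightarrow> \<not> near L (4 * t) (y i) (y k))" for P
  have fing: "finite good" using finI by (simp add: good_def)
  have "finite {P. sep P}" 
    by (rule finite_subset[of _ "Pow good"]) (auto simp: sep_def fing)
  moreover have "{} \<in> {P. sep P}" by (simp add: sep_def)
  ultimately obtain Q where Q: "sep Q" and mx: "\<And>R. sep R \<Longrightarrow> Q \<subseteq> R \<Longrightarrow> Q = R"
    using finite_has_maximal[of "{P. sep P}"] by blast
  have finQ: "finite Q" using Q fing finite_subset by (auto simp: sep_def)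
  have cover: "\<exists>k\<in>Q. near L (4 * t) (y k) (y i)" if i: "i \<in> good" for i
  proof (rule ccontr)
    assume neg: "\<not> ?thesis"
    have "near L (4 * t) (y i) (y i)" using t0 by (simp add: near_def)
    hence "i \<notin> Q" using neg by blast
    moreover have "sep (insert i Q)"
      using Q i neg near_sym[of L "4 * t"] unfolding sep_def by blast
    ultimately show False using mx[of "insert i Q"] by blast
  qed
  have "N + 1 \<le> card Q"
  proof (rule ccontr)
    assume "\<not> N + 1 \<le> card Q"
    hence cQ: "real (card Q) \<le> n" by (simp add: n_def)
    define Nb where "Nb k = {j\<in>J. near L (5 * t) (y k) (f j)}" for k
    define U where "U = (\<Union>k\<in>Q. Nb k)"
    have "mu (J - U) \<le> 2 * (1 + n) * \<beta>"
    proof (rule orphan_mass)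
      fix j i assume j: "j \<in> J - U" and i: "i \<in> good"
      obtain k where k: "k \<in> Q" "near L (4 * t) (y k) (y i)" using cover[OF i] by blast
      show "\<not> adj i j"
      proof
        assume "adj i j"
        hence "near L (4 * t + t) (y k) (f j)" unfolding adj_def by (rule near_trans[OF k(2)])
        hence "near L (5 * t) (y k) (f j)" by simp
        hence "j \<in> U" using j k by (auto simp: U_def Nb_def)
        thus False using j by simp
      qed
    qed auto
    moreover have "mu U \<le> (\<Sum>k\<in>Q. mu (Nb k))"
      unfolding mu_def U_def using finQ
    proof (induction Q rule: finite_induct)
      case (insert k F)
      have "(\<Sum>j\<in>(\<Union>k\<in>insert k F. Nb k). l j * (1 + a j)) \<le> 
         (\<Sum>j\<in>Nb k. l j * (1 + a j)) + (\<Sum>j\<in>(\<Union>k\<in>F. Nb k). l j * (1 + a j))"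
        unfolding UN_insert
        by (subst sum_Un) (auto simp: Nb_def finJ insert.hyps intro!: sum_nonneg mult_nonneg_nonneg l0 a_ge)
      with insert show ?case by simp
    qed auto
    moreover have "(\<Sum>k\<in>Q. mu (Nb k)) \<le> (\<Sum>k\<in>Q. abar + 5 * t)"
      using Q t0 by (intro sum_mono mu_near_le) (auto simp: Nb_def sep_def good_def)
    moreover have "(\<Sum>k\<in>Q. abar + 5 * t) \<le> n * (abar + 5 * t)"
      using cQ t0 abar_ge n_pos by (simp add: mult_right_mono add_nonneg_nonneg order_trans[of 0 "1/n"])
    moreover have "mu J = mu (J - U) + mu U"
      unfolding mu_def by (rule sum.subset_diff) (auto simp: U_def Nb_def finJ)
    ultimately have "1 + abar \<le> n * abar + 5 * n * t + 2 * (1 + n) * \<beta>"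
      unfolding mu_total by (simp add: algebra_simps)
    with abar_le abar_ge slack show False by linarith
  qed
  then obtain P where P: "P \<subseteq> Q" "card P = N + 1"
    by (metis obtain_subset_with_card_n)
  show thesis
  proof (rule that[OF _ P(2)])
    show "P \<subseteq> good" using P(1) Q unfolding sep_def by blast
    show "\<not> near L (4 * t) (y i) (y k)" if "i \<in> P" "k \<in> P" "i \<noteq> k" for i k
      using Q that P(1) unfolding sep_def by blast
  qed
qed

text \<open>For each member \<open>k\<close> of the separated family, the half-spaces are averaged over the functionals near
\<open>y k\<close>, and the contact points over the normals near one well chosen functional \<open>h k\<close> of that
cluster. Within a cluster the value of \<open>g\<close> is nearly maximal; across clusters separation makes all
pairs far, and the total far weight is at most \<open>\<beta>\<close>.\<close>

theorem almost_simplex: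
  obtains P v \<phi> \<alpha> where "finite (P :: 'i set)" "card P = N + 1"
    "\<And>k. k \<in> P \<Longrightarrow> v k \<in> convex hull (x ` I)"
    "\<And>k u. k \<in> P \<Longrightarrow> (\<And>j. j \<in> J \<Longrightarrow> 0 \<le> u \<bullet> f j + a j) \<Longrightarrow> 0 \<le> u \<bullet> \<phi> k + \<alpha> k"
    "\<And>k. k \<in> P \<Longrightarrow> 4 / (5 * n) \<le> v k \<bullet> \<phi> k + \<alpha> k"
    "\<And>k m. k \<in> P \<Longrightarrow> m \<in> P \<Longrightarrow> m \<noteq> k \<Longrightarrow> v m \<bullet> \<phi> k + \<alpha> k \<le> 3 * n * \<beta>"
proof -
  obtain P where P: "P \<subseteq> good" "card P = N + 1"
    and sep: "\<And>i k. i \<in> P \<Longrightarrow> k \<in> P \<Longrightarrow> i \<noteq> k \<Longrightarrow> \<not> near L (4 * t) (y i) (y k)"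
    using separated_family by blast
  have PI: "P \<subseteq> I" using P by (auto simp: good_def)
  have finP: "finite P" using finite_subset[OF PI finI] .
  have JJ: "Jof k \<subseteq> J" for k by (auto simp: Jof_def)
  have "\<exists>j\<in>Jof k. Gfar j < 1/2" if k: "k \<in> P" for k
  proof (rule ccontr)
    assume "\<not> ?thesis"
    hence "sum l (Jof k) \<le> 2 * \<beta>" using JJ by (intro markov_Gfar) (auto simp: not_less)
    hence "(1 + n) * sum l (Jof k) \<le> (1 + n) * (2 * \<beta>)" using n_pos by (intro mult_left_mono) auto
    hence "(1 + n) * sum l (Jof k) \<le> 2 * (1 + n) * \<beta>" by (simp only: mult_ac)
    moreover have "7 / (8 * n) \<le> mu (Jof k)" using mu_Jof_ge P k by auto
    ultimately have "7 / (8 * n) \<le> 2 * (1 + n) * \<beta>" 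
      using mu_le[OF JJ, of k] by linarith
    with orphan_mass_small have "7 / (8 * n) \<le> 1 / (8 * n)" by (rule order_trans[rotated])
    thus False using n_pos by (simp add: field_simps)
  qed
  then obtain h where h: "\<And>k. k \<in> P \<Longrightarrow> h k \<in> Jof k \<and> Gfar (h k) < 1/2" by metis
  hence hJ: "\<And>k. k \<in> P \<Longrightarrow> h k \<in> J" using JJ by blast
  define C where "C k = sum c (Iof (h k))" for k
  have II: "Iof j \<subseteq> I" for j by (auto simp: Iof_def)
  have C: "1 / (3 * n) \<le> C k" if k: "k \<in> P" for k
  proof -
    have "1/2 \<le> (1 + a (h k)) * C k" using Iof_mass[OF hJ[OF k]] h[OF k] by (simp add: C_def)
    also have "\<dots> \<le> (1 + n) * C k"
      using an[OF hJ[OF k]] II by (intro mult_right_mono) (auto simp: C_def intro!: sum_nonneg c0)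
    also have "\<dots> \<le> (3/2 * n) * C k"
      using n2 II by (intro mult_right_mono) (auto simp: C_def intro!: sum_nonneg c0)
    finally show ?thesis using n_pos by (simp add: field_simps)
  qed
  have C0: "0 < C k" if "k \<in> P" for k 
    using n_pos by (intro less_le_trans[OF _ C[OF that]]) simp
  define v where "v k = (\<Sum>i\<in>Iof (h k). (c i / C k) *\<^sub>R x i)" for k
  define \<phi> where "\<phi> k = (\<Sum>j\<in>Jof k. l j *\<^sub>R f j)" for k
  define \<alpha> where "\<alpha> k = (\<Sum>j\<in>Jof k. l j * a j)" for k
  have csum1: "(\<Sum>i\<in>Iof (h k). c i / C k) = 1" if "k \<in> P" for k
    using C0[OF that] by (simp add: C_def sum_divide_distrib[symmetric])
  have lin: "u \<bullet> \<phi> k + \<alpha> k = (\<Sum>j\<in>Jof k. l j * (u \<bullet> f j + a j))" for u k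
    by (simp add: \<phi>_def \<alpha>_def inner_sum_right distrib_left sum.distrib)
  have val: "v m \<bullet> \<phi> k + \<alpha> k = (\<Sum>i\<in>Iof (h m). c i / C m * (\<Sum>j\<in>Jof k. l j * g i j))" 
    if "m \<in> P" for m k
  proof -
    have "(\<Sum>i\<in>Iof (h m). c i / C m * (\<Sum>j\<in>Jof k. l j * g i j)) = 
          (\<Sum>i\<in>Iof (h m). c i / C m * (x i \<bullet> \<phi> k + \<alpha> k))"
      by (simp add: lin g_def)
    also have "\<dots> = (\<Sum>i\<in>Iof (h m). c i / C m * (x i \<bullet> \<phi> k)) + (\<Sum>i\<in>Iof (h m). c i / C m) * \<alpha> k"
      by (simp only: distrib_left sum.distrib sum_distrib_right)
    finally show ?thesis using csum1[OF that] by (simp add: v_def inner_sum_left)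
  qed
  show thesis
  proof (rule that[of P v \<phi> \<alpha>])
    show "finite P" "card P = N + 1" by fact+
    fix k assume k: "k \<in> P"
    show "v k \<in> convex hull (x ` I)"
      unfolding v_def using csum1[OF k] C0[OF k] II finite_subset[OF II finI]
      by (intro convex_sum) (auto intro!: hull_inc divide_nonneg_nonneg c0 simp: less_imp_le)
    show "0 \<le> u \<bullet> \<phi> k + \<alpha> k" if "\<And>j. j \<in> J \<Longrightarrow> 0 \<le> u \<bullet> f j + a j" for u
      unfolding lin using that JJ by (intro sum_nonneg mult_nonneg_nonneg) (auto intro: l0)
    show "4 / (5 * n) \<le> v k \<bullet> \<phi> k + \<alpha> k"
    proof -
      have inner: "4 / (5 * n) \<le> (\<Sum>j\<in>Jof k. l j * g i j)" if i: "i \<in> Iof (h k)" for i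
      proof -
        have iI: "i \<in> I" using i II by auto
        have nr: "near L (t + t + t) (y i) (f j)" if j: "j \<in> Jof k" for j
        proof -
          have 1: "near L t (y i) (f (h k))" using i by (simp add: Iof_def adj_def)
          have 2: "near L t (y k) (f (h k))" using h[OF k] by (simp add: Jof_def adj_def)
          have 3: "near L t (y k) (f j)" using j by (simp add: Jof_def adj_def)
          show ?thesis using near_trans[OF near_trans[OF 1 near_sym[OF 2]] 3] .
        qed
        have "mu (Jof k) - 3 * t * sum l (Jof k) = (\<Sum>j\<in>Jof k. l j * (1 + a j - (t + t + t)))"
          by (simp add: mu_def sum_distrib_left algebra_simps sum_subtractf sum.distrib)
        also have "\<dots> \<le> (\<Sum>j\<in>Jof k. l j * g i j)"
          using JJ iI nr by (intro sum_mono mult_left_mono g_near l0) auto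
        finally have 1: "mu (Jof k) - 3 * t * sum l (Jof k) \<le> (\<Sum>j\<in>Jof k. l j * g i j)" .
        have "sum l (Jof k) \<le> 1"
          unfolding lsum[symmetric] using JJ by (intro sum_mono2) (auto simp: finJ l0)
        hence "3 * t * sum l (Jof k) \<le> 3 * t" using t0 mult_left_le[of "sum l (Jof k)" "3 * t"] by simp
        moreover have "3 * t \<le> 3 / (40 * n)"
        proof -
          have "1 / (20 * n\<^sup>2) \<le> 1 / (40 * n)" using n2 by (simp add: field_simps power2_eq_square)
          thus ?thesis using t1 by simp
        qed
        moreover have "7 / (8 * n) \<le> mu (Jof k)" using mu_Jof_ge P k by auto
        moreover have "4 / (5 * n) = 7 / (8 * n) - 3 / (40 * n)" using n_pos by (simp add: field_simps)
        ultimately show ?thesis using 1 by linarith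
      qed
      have "4 / (5 * n) = (\<Sum>i\<in>Iof (h k). c i / C k * (4 / (5 * n)))"
        by (simp only: sum_distrib_right[symmetric] csum1[OF k] mult_1)
      also have "\<dots> \<le> (\<Sum>i\<in>Iof (h k). c i / C k * (\<Sum>j\<in>Jof k. l j * g i j))"
        using C0[OF k] II inner by (intro sum_mono mult_left_mono divide_nonneg_pos) (auto intro: c0)
      finally show ?thesis unfolding val[OF k] .
    qed
    fix m assume m: "m \<in> P" and mk: "m \<noteq> k"
    have far: "\<not> adj i j" if i: "i \<in> Iof (h m)" and j: "j \<in> Jof k" for i j
    proof
      assume "adj i j"
      hence 1: "near L t (y i) (f j)" by (simp add: adj_def)
      have 2: "near L t (y k) (f j)" using j by (simp add: Jof_def adj_def)
      have 3: "near L t (y i) (f (h m))" using i by (simp add: Iof_def adj_def)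
      have 4: "near L t (y m) (f (h m))" using h[OF m] by (simp add: Jof_def adj_def)
      have "near L (t + t + t + t) (y k) (y m)"
        using near_trans[OF near_trans[OF near_trans[OF 2 near_sym[OF 1]] 3] near_sym[OF 4]] .
      thus False using sep[OF k m] mk by simp
    qed
    have "(\<Sum>i\<in>Iof (h m). c i * (\<Sum>j\<in>Jof k. l j * g i j)) \<le> (\<Sum>i\<in>Iof (h m). c i * Ffar i)"
      unfolding Ffar_def
    proof (intro sum_mono mult_left_mono sum_mono2)
      fix i assume i: "i \<in> Iof (h m)"
      show "Jof k \<subseteq> J - Jof i" using far[OF i] by (auto simp: Jof_def)
      show "0 \<le> c i" using i II c0 by auto
      fix j assume "j \<in> J - Jof i - Jof k"
      moreover have "i \<in> I" using i II by blast
      ultimately show "0 \<le> l j * g i j" by (simp add: l0 g_nonneg)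
    qed (auto simp: finJ)
    also have "\<dots> \<le> (\<Sum>i\<in>I. c i * Ffar i)"
      by (intro sum_mono2) (auto simp: finI II c0 Ffar_nonneg)
    also have "\<dots> \<le> \<beta>" by (rule sum_Ffar)
    finally have *: "(\<Sum>i\<in>Iof (h m). c i * (\<Sum>j\<in>Jof k. l j * g i j)) \<le> \<beta>" .
    have "v m \<bullet> \<phi> k + \<alpha> k = (\<Sum>i\<in>Iof (h m). c i * (\<Sum>j\<in>Jof k. l j * g i j)) / C m"
      unfolding val[OF m] by (simp add: sum_divide_distrib)
    also have "\<dots> \<le> \<beta> / C m" using * C0[OF m] by (simp add: divide_right_mono)
    also have "\<dots> \<le> \<beta> / (1 / (3 * n))" using C[OF m] C0[OF m] beta0 n_pos
      by (intro divide_left_mono) auto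
    finally show "v m \<bullet> \<phi> k + \<alpha> k \<le> 3 * n * \<beta>" by (simp add: mult.commute)
  qed
qed

end

section \<open>Stability for abstractly given closeness of normals\<close>

text \<open>The constant arises from \<open>almost_simplex\<close>: off-diagonal entries at most \<open>3 n \<beta>\<close> against a diagonal of
at least \<open>4 / (5 n)\<close> allow barycentric coordinates down to \<open>- 4 n\<^sup>2 \<beta>\<close>, and \<open>n + 1 \<le> 3 n / 2\<close>.\<close>

theorem stability_of_simplices:
  fixes K L S :: "(real^'n) set" and \<epsilon> \<beta> \<eta> t n :: real
  defines "n \<equiv> real CARD('n)"
  assumes n2: "2 \<le> n" and L: "convex_body L" "0 \<in> interior L" and Ln: "L \<subseteq> (*\<^sub>R) (- n) ` L"
    and K: "convex_body K" and far: "(1 - \<epsilon>) * n \<le> grunbaum_dist K L" and S: "regular_simplex S"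
    and \<epsilon>: "0 \<le> \<epsilon>" "\<epsilon> < 1" 
    and close: "\<And>f g z. f \<in> polar_body L \<Longrightarrow> g \<in> polar_body L \<Longrightarrow> z \<in> L \<Longrightarrow> z \<bullet> f = 1 \<Longrightarrow>
        1 - \<eta> < z \<bullet> g \<Longrightarrow> near L t g f"
    and \<eta>: "0 < \<eta>" and t: "0 \<le> t" "t \<le> 1 / (20 * n\<^sup>2)"
    and \<beta>: "\<epsilon> / (1 - \<epsilon>) \<le> \<beta>" "\<epsilon> / (1 - \<epsilon>) \<le> \<beta> * \<eta>" "\<beta> \<le> 1 / (64 * n ^ 4)"
  shows "banach_mazur_dist K S \<le> 1 + 6 * n ^ 3 * \<beta>"
proof -
  have n0: "0 < n" using n2 by simp
  have cL: "compact L" "convex L" "closed L" "0 \<in> L" 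
    using L compact_imp_closed interior_subset by (auto simp: convex_body_def)
  obtain T d where T: "linear T" "bij T" and TK: "(\<lambda>x. T x + d) ` K \<subseteq> L"
    and ext: "\<And>A w. (\<And>x. x \<in> (\<lambda>x. T x + d) ` K \<Longrightarrow> A *v x + w \<in> L) \<Longrightarrow> det A \<le> 1"
    using maximal_volume_position[OF K L(1)] by blast
  define K' where "K' = (\<lambda>x. T x + d) ` K"
  have K'L: "K' \<subseteq> L" using TK by (simp add: K'_def)
  have "K \<noteq> {}" using K interior_subset by (auto simp: convex_body_def)
  have K': "compact K'" "convex K'" "K' \<noteq> {}"
  proof -
    have "continuous_on K T" using T(1) by (simp add: linear_continuous_on linear_conv_bounded_linear)
    thus "compact K'" using K unfolding K'_def convex_body_def
      by (intro compact_continuous_image continuous_intros) auto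
    have "K' = (\<lambda>x. x + d) ` T ` K" by (auto simp: K'_def)
    thus "convex K'" using K T(1)
      by (simp add: convex_body_def convex_linear_image convex_translation_eq add.commute[of _ d])
    show "K' \<noteq> {}" using \<open>K \<noteq> {}\<close> by (simp add: K'_def)
  qed
  obtain I :: "nat set" and c :: "nat \<Rightarrow> real" and x y where J1:
    "finite I" "\<And>i. i \<in> I \<Longrightarrow> 0 \<le> c i" "sum c I = CARD('n)"
    "\<And>i. i \<in> I \<Longrightarrow> x i \<in> K'" "\<And>i. i \<in> I \<Longrightarrow> y i \<in> polar_body L" "\<And>i. i \<in> I \<Longrightarrow> x i \<bullet> y i = 1"
    "\<And>u. (\<Sum>i\<in>I. (c i * (u \<bullet> y i)) *\<^sub>R x i) = u" "(\<Sum>i\<in>I. c i *\<^sub>R y i) = 0"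
    using extremal_position_imp_decomposition[OF K'(1) cL(2,3) L(2) K'L] ext unfolding K'_def by blast
  define \<tau> where "\<tau> = 1 / ((1 - \<epsilon>) * n)"
  have \<tau>: "0 < \<tau>" using \<epsilon> n0 by (simp add: \<tau>_def)
  have asym: "- n \<le> x \<bullet> f" if xL: "x \<in> L" and f: "f \<in> polar_body L" for x f
  proof -
    obtain w where w: "w \<in> L" "x = (- n) *\<^sub>R w" using Ln xL by blast
    have "n * (w \<bullet> f) \<le> n * 1"
      using f w n0 by (intro mult_left_mono) (auto simp: polar_body_def inner_commute)
    thus ?thesis using w by simp
  qed
  have nofit: "\<exists>x\<in>L. - w - \<kappa> *\<^sub>R x \<notin> K'" if "\<tau> < \<kappa>" for w \<kappa>
    unfolding K'_def using far by (intro grunbaum_no_fit[OF T TK _ \<tau> that]) (simp add: \<tau>_def)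
  obtain J :: "nat set" and l a :: "nat \<Rightarrow> real" and f z where J2:
    "finite J" "\<And>j. j \<in> J \<Longrightarrow> 0 \<le> l j" "sum l J = 1" "(\<Sum>j\<in>J. l j *\<^sub>R f j) = 0"
    "\<And>j. j \<in> J \<Longrightarrow> f j \<in> polar_body L" "\<And>j. j \<in> J \<Longrightarrow> z j \<in> L" "\<And>j. j \<in> J \<Longrightarrow> z j \<bullet> f j = 1"
    "\<And>j. j \<in> J \<Longrightarrow> a j \<le> n" "\<And>j u. j \<in> J \<Longrightarrow> u \<in> K' \<Longrightarrow> 0 \<le> u \<bullet> f j + a j"
    "(\<Sum>j\<in>J. l j * a j) \<le> \<tau>"
    by (rule homothet_certificate[OF K' cL(1) L(2) K'L asym nofit \<tau>]) blast+
  have pol: "w \<bullet> g \<le> 1" if "w \<in> L" "g \<in> polar_body L" for w g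
    using that by (auto simp: polar_body_def inner_commute)
  have \<tau>': "\<tau> = (1 + \<epsilon> / (1 - \<epsilon>)) / n" using \<epsilon> n0 by (simp add: \<tau>_def field_simps)
  \<comment> \<open>the sum of the \<open>l j * a j\<close> is at most \<open>\<tau>\<close>, which is \<open>(1 + e) / n\<close> for \<open>e = \<epsilon> / (1 - \<epsilon>)\<close>\<close>
  interpret contact_system L "CARD('n)" n t \<eta> \<beta> "\<epsilon> / (1 - \<epsilon>)" I c x y J l a f z
  proof
    show "n = real CARD('n)" by (simp add: n_def)
    show "sum c I = n" using J1(3) by (simp add: n_def)
    show "(\<Sum>j\<in>J. l j * a j) \<le> (1 + \<epsilon> / (1 - \<epsilon>)) / n" using J2(10) \<tau>' by simp
    show "0 \<le> \<epsilon> / (1 - \<epsilon>)" using \<epsilon> by simp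
    show "near L t (y i) (f j)" if "i \<in> I" "j \<in> J" "1 - \<eta> < z j \<bullet> y i" for i j
      using that J1 J2 by (intro close[of "f j" "y i" "z j"]) auto
  qed (use J1 J2 K'L pol n2 \<eta> t \<beta> in auto)
  obtain P v \<phi> \<alpha> where P: "finite (P :: nat set)" "card P = CARD('n) + 1"
    and v: "\<And>k. k \<in> P \<Longrightarrow> v k \<in> convex hull (x ` I)"
    and pos: "\<And>k u. k \<in> P \<Longrightarrow> (\<And>j. j \<in> J \<Longrightarrow> 0 \<le> u \<bullet> f j + a j) \<Longrightarrow> 0 \<le> u \<bullet> \<phi> k + \<alpha> k"
    and diag: "\<And>k. k \<in> P \<Longrightarrow> 4 / (5 * n) \<le> v k \<bullet> \<phi> k + \<alpha> k"
    and off: "\<And>k m. k \<in> P \<Longrightarrow> m \<in> P \<Longrightarrow> m \<noteq> k \<Longrightarrow> v m \<bullet> \<phi> k + \<alpha> k \<le> 3 * n * \<beta>"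
    using almost_simplex by blast
  have hull: "convex hull (x ` I) \<subseteq> K'" using J1(4) K'(2) by (intro hull_minimal) auto
  have \<beta>0: "0 \<le> \<beta>" using \<beta>(1) \<epsilon> by (meson divide_nonneg_nonneg diff_ge_0_iff_ge less_imp_le order_trans)
  have small: "(n + 1) * (3 * n * \<beta>) \<le> 1 / (20 * n)"
  proof -
    have "(n + 1) * (3 * n * \<beta>) \<le> (3/2 * n) * (3 * n * (1 / (64 * n ^ 4)))"
      using \<beta>(3) \<beta>0 n2 by (intro mult_mono) auto
    also have "\<dots> = (9 / 128) / n\<^sup>2" using n0 by (simp add: field_simps power_def)
    also have "\<dots> \<le> 1 / (20 * n)" using n2 by (simp add: field_simps power2_eq_square)
    finally show ?thesis .
  qed
  have "sandwiched K' S (1 + (DIM(real^'n) + 1) * (4 * n\<^sup>2 * \<beta>))"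
  proof (rule simplex_from_dominant_matrix[OF S K'(2) P(1)])
    show "card P = DIM(real^'n) + 1" using P(2) by simp
    show "v k \<in> K'" if "k \<in> P" for k using v[OF that] hull by blast
    show "0 \<le> u \<bullet> \<phi> k + \<alpha> k" if "k \<in> P" "u \<in> K'" for k u
      using J2(9) that by (intro pos) auto
    show "4 / (5 * n) \<le> v k \<bullet> \<phi> k + \<alpha> k" if "k \<in> P" for k using diag[OF that] .
    show "v m \<bullet> \<phi> k + \<alpha> k \<le> 3 * n * \<beta>" if "k \<in> P" "m \<in> P" "m \<noteq> k" for k m using off[OF that] .
    show "0 \<le> 3 * n * \<beta>" using \<beta>0 n0 by simp
    have dim: "real (DIM(real^'n) + 1) = n + 1" by (simp add: n_def)
    have "1 / (20 * n) < 4 / (5 * n)" using n0 by (simp add: field_simps)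
    thus "real (DIM(real^'n) + 1) * (3 * n * \<beta>) < 4 / (5 * n)" unfolding dim using small by linarith
    have "3 / (4 * n) \<le> 4 / (5 * n) - real (DIM(real^'n) + 1) * (3 * n * \<beta>)"
    proof -
      have "4 / (5 * n) - 1 / (20 * n) = 3 / (4 * n)" using n0 by (simp add: field_simps)
      thus ?thesis unfolding dim using small by linarith
    qed
    hence "4 * n\<^sup>2 * \<beta> * (3 / (4 * n)) \<le> 4 * n\<^sup>2 * \<beta> * (4 / (5 * n) - real (DIM(real^'n) + 1) * (3 * n * \<beta>))"
      using \<beta>0 by (intro mult_left_mono) auto
    moreover have "4 * n\<^sup>2 * \<beta> * (3 / (4 * n)) = 3 * n * \<beta>" using n0 by (simp add: field_simps power2_eq_square)
    ultimately show "3 * n * \<beta> \<le> 4 * n\<^sup>2 * \<beta> * (4 / (5 * n) - real (DIM(real^'n) + 1) * (3 * n * \<beta>))" by simp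
  qed
  hence "sandwiched K S (1 + (DIM(real^'n) + 1) * (4 * n\<^sup>2 * \<beta>))"
    unfolding K'_def by (rule sandwiched_affine_image_left[OF T])
  hence "banach_mazur_dist K S \<le> 1 + (DIM(real^'n) + 1) * (4 * n\<^sup>2 * \<beta>)"
    using \<beta>0 by (intro banach_mazur_dist_le) (auto intro: add_pos_nonneg)
  also have "\<dots> = 1 + (n + 1) * (4 * n\<^sup>2 * \<beta>)" by (simp add: n_def)
  also have "\<dots> \<le> 1 + (3/2 * n) * (4 * n\<^sup>2 * \<beta>)"
    using \<beta>0 n2 by (intro add_left_mono mult_right_mono) auto
  also have "\<dots> = 1 + 6 * n ^ 3 * \<beta>" by (simp add: power2_eq_square power3_eq_cube)
  finally show ?thesis .
qed

section \<open>The modulus of convexity of the polar body\<close>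

lemma gauge_polar_le:
  assumes t: "0 < t" and le: "\<And>z. z \<in> L \<Longrightarrow> z \<bullet> f \<le> t"
  shows "gauge_fun (polar_body L) f \<le> t"
  unfolding gauge_fun_def
proof (rule cInf_lower)
  have "(1 / t) *\<^sub>R f \<in> polar_body L"
    using le t by (simp add: polar_body_def inner_commute field_simps)
  moreover have "f = t *\<^sub>R (1 / t) *\<^sub>R f" using t by simp
  ultimately show "t \<in> {t. 0 < t \<and> f \<in> (*\<^sub>R) t ` polar_body L}" using t by blast
  show "bdd_below {t. 0 < t \<and> f \<in> (*\<^sub>R) t ` polar_body L}" by (rule bdd_belowI[of _ 0]) auto
qed

lemma gauge_polar_ge:
  fixes L :: "'a::euclidean_space set"
  assumes L: "compact L" and z: "z \<in> L"
  shows "z \<bullet> f \<le> gauge_fun (polar_body L) f"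
  unfolding gauge_fun_def
proof (rule cInf_greatest)
  obtain M where M: "0 < M" "\<And>x. x \<in> L \<Longrightarrow> norm x \<le> M"
    using compact_imp_bounded[OF L] by (auto simp: bounded_pos)
  define t where "t = M * norm f + 1"
  have t: "0 < t" using M(1) by (simp add: t_def add_nonneg_pos)
  have "x \<bullet> f \<le> t" if "x \<in> L" for x
    using norm_cauchy_schwarz[of x f] mult_right_mono[OF M(2)[OF that], of "norm f"] by (simp add: t_def)
  hence "(1 / t) *\<^sub>R f \<in> polar_body L" 
    using t by (simp add: polar_body_def inner_commute field_simps)
  moreover have "f = t *\<^sub>R (1 / t) *\<^sub>R f" using t by simp
  ultimately have "t \<in> {t. 0 < t \<and> f \<in> (*\<^sub>R) t ` polar_body L}" using t by blast
  thus "{t. 0 < t \<and> f \<in> (*\<^sub>R) t ` polar_body L} \<noteq> {}" by blast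
  fix s assume "s \<in> {t. 0 < t \<and> f \<in> (*\<^sub>R) t ` polar_body L}"
  then obtain h where h: "0 < s" "h \<in> polar_body L" "f = s *\<^sub>R h" by auto
  have "z \<bullet> h \<le> 1" using h(2) z by (auto simp: polar_body_def inner_commute)
  thus "z \<bullet> f \<le> s" using h by simp
qed

text \<open>The gauge of the polar body is the support function of \<open>L\<close>, and its supremum is attained.\<close>

lemma gauge_polar_attained:
  fixes L :: "'a::euclidean_space set"
  assumes L: "compact L" "0 \<in> L"
  obtains z where "z \<in> L" "z \<bullet> f = gauge_fun (polar_body L) f"
proof -
  have "\<exists>z\<in>L. \<forall>x\<in>L. x \<bullet> f \<le> z \<bullet> f"
    using L by (intro continuous_attains_sup continuous_intros) auto
  then obtain z where z: "z \<in> L" "\<And>x. x \<in> L \<Longrightarrow> x \<bullet> f \<le> z \<bullet> f" by blast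
  have "0 \<le> z \<bullet> f" using z(2)[OF L(2)] by simp
  have "gauge_fun (polar_body L) f \<le> z \<bullet> f"
  proof (rule field_le_epsilon)
    fix e :: real assume "0 < e"
    show "gauge_fun (polar_body L) f \<le> z \<bullet> f + e"
    proof (rule gauge_polar_le)
      show "0 < z \<bullet> f + e" using \<open>0 < e\<close> \<open>0 \<le> z \<bullet> f\<close> by simp
      show "x \<bullet> f \<le> z \<bullet> f + e" if "x \<in> L" for x using z(2)[OF that] \<open>0 < e\<close> by simp
    qed
  qed
  with gauge_polar_ge[OF L(1) z(1), of f] z(1) show thesis by (intro that[of z]) auto
qed

lemma modulus_le:
  fixes L :: "'a::euclidean_space set"
  assumes L: "compact L" "0 \<in> L" and f: "f \<in> polar_body L" "g \<in> polar_body L"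
    and t: "t \<le> gauge_fun (polar_body L) (f - g)"
  shows "modulus_of_convexity (polar_body L) t \<le> 1 - gauge_fun (polar_body L) ((1/2) *\<^sub>R (f + g))"
  unfolding modulus_of_convexity_def
proof (rule cInf_lower)
  have "0 \<le> 1 - gauge_fun (polar_body L) ((1/2) *\<^sub>R (f + g))" 
    if "f \<in> polar_body L" "g \<in> polar_body L" for f g
  proof -
    have "z \<bullet> (1/2) *\<^sub>R (f + g) \<le> 1" if z: "z \<in> L" for z
    proof -
      have "f \<bullet> z \<le> 1" "g \<bullet> z \<le> 1"
        using \<open>f \<in> polar_body L\<close> \<open>g \<in> polar_body L\<close> z by (auto simp: polar_body_def)
      thus ?thesis by (simp add: inner_add_right inner_commute)
    qed
    from gauge_polar_le[OF _ this] show ?thesis by simp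
  qed
  thus "bdd_below {1 - gauge_fun (polar_body L) ((1/2) *\<^sub>R (x + y)) |x y.
         x \<in> polar_body L \<and> y \<in> polar_body L \<and> t \<le> gauge_fun (polar_body L) (x - y)}"
    by (intro bdd_belowI[of _ 0]) blast
qed (use f t in blast)

text \<open>The infimum is over a nonempty set: a functional that attains the value one on \<open>L\<close> has distance at
least one from zero, which is where \<open>t \<le> 1\<close> enters.\<close>

lemma modulus_greatest:
  fixes L :: "'a::euclidean_space set"
  assumes L: "compact L" "0 \<in> interior L" and t: "t \<le> 1"
    and ge: "\<And>f g. f \<in> polar_body L \<Longrightarrow> g \<in> polar_body L \<Longrightarrow> t \<le> gauge_fun (polar_body L) (f - g) \<Longrightarrow>
        m \<le> 1 - gauge_fun (polar_body L) ((1/2) *\<^sub>R (f + g))"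
  shows "m \<le> modulus_of_convexity (polar_body L) t"
  unfolding modulus_of_convexity_def
proof (rule cInf_greatest)
  obtain e :: 'a where "e \<noteq> 0" using nonzero_Basis nonempty_Basis by blast
  then obtain h z where hz: "(1 / h) *\<^sub>R e \<in> polar_body L" "z \<in> L" "z \<bullet> (1 / h) *\<^sub>R e = 1"
    by (rule supporting_functional[OF L])
  have "1 \<le> gauge_fun (polar_body L) ((1 / h) *\<^sub>R e - 0)"
    using gauge_polar_ge[OF L(1) hz(2), of "(1 / h) *\<^sub>R e"] hz(3) by simp
  hence "t \<le> gauge_fun (polar_body L) ((1 / h) *\<^sub>R e - 0)" using t by linarith
  moreover have "0 \<in> polar_body L" by (simp add: polar_body_def)
  ultimately show "{1 - gauge_fun (polar_body L) ((1/2) *\<^sub>R (x + y)) |x y.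
         x \<in> polar_body L \<and> y \<in> polar_body L \<and> t \<le> gauge_fun (polar_body L) (x - y)} \<noteq> {}"
    using hz(1) by blast
qed (use ge in blast)

lemma modulus_mono:
  fixes L :: "'a::euclidean_space set"
  assumes L: "compact L" "0 \<in> interior L" and st: "s \<le> t" "t \<le> 1"
  shows "modulus_of_convexity (polar_body L) s \<le> modulus_of_convexity (polar_body L) t"
  using L st interior_subset by (intro modulus_greatest modulus_le) auto

lemma modulus_le_1:
  fixes L :: "'a::euclidean_space set"
  assumes L: "compact L" "0 \<in> interior L" and t: "t \<le> 1"
  shows "modulus_of_convexity (polar_body L) t \<le> 1"
proof -
  have L0: "0 \<in> L" using L(2) interior_subset by blast
  obtain e :: 'a where "e \<noteq> 0" using nonzero_Basis nonempty_Basis by blast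
  then obtain h z where hz: "(1 / h) *\<^sub>R e \<in> polar_body L" "z \<in> L" "z \<bullet> (1 / h) *\<^sub>R e = 1"
    by (rule supporting_functional[OF L])
  have "1 \<le> gauge_fun (polar_body L) ((1 / h) *\<^sub>R e - 0)"
    using gauge_polar_ge[OF L(1) hz(2), of "(1 / h) *\<^sub>R e"] hz(3) by simp
  hence "t \<le> gauge_fun (polar_body L) ((1 / h) *\<^sub>R e - 0)" using t by linarith
  moreover have "0 \<in> polar_body L" by (simp add: polar_body_def)
  ultimately have "modulus_of_convexity (polar_body L) t \<le> 
      1 - gauge_fun (polar_body L) ((1/2) *\<^sub>R ((1 / h) *\<^sub>R e + 0))"
    using hz(1) by (intro modulus_le[OF L(1) L0]) auto
  moreover have "0 \<le> gauge_fun (polar_body L) ((1/2) *\<^sub>R ((1 / h) *\<^sub>R e + 0))"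
    using gauge_polar_ge[OF L(1) L0] by fastforce
  ultimately show ?thesis by linarith
qed

text \<open>If \<open>f\<close> and \<open>g\<close> were \<open>t\<close> apart, their midpoint would have gauge at most \<open>1 - \<delta>(t)\<close>; but at \<open>z\<close> the
midpoint exceeds \<open>1 - \<delta>(t) / 2\<close>. The modulus is symmetric in its two points, so both one-sided
distances are small although the gauge need not be symmetric.\<close>

lemma modulus_closeness:
  fixes L :: "'a::euclidean_space set"
  assumes L: "compact L" "0 \<in> L" and fg: "f \<in> polar_body L" "g \<in> polar_body L"
    and z: "z \<in> L" "z \<bullet> f = 1" and d: "0 < modulus_of_convexity (polar_body L) t"
    and close: "1 - modulus_of_convexity (polar_body L) t < z \<bullet> g"
  shows "near L t g f"
proof -
  let ?d = "modulus_of_convexity (polar_body L) t"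
  have mid: "1 - ?d < gauge_fun (polar_body L) ((1/2) *\<^sub>R (f + g))"
    using gauge_polar_ge[OF L(1) z(1), of "(1/2) *\<^sub>R (f + g)"] z(2) close d 
    by (simp add: inner_add_right)
  have 1: "gauge_fun (polar_body L) (f - g) < t"
    using modulus_le[OF L fg, of t] mid by linarith
  have 2: "gauge_fun (polar_body L) (g - f) < t"
    using modulus_le[OF L fg(2,1), of t] mid unfolding add.commute[of g f] by linarith
  show ?thesis unfolding near_def
  proof
    fix w assume w: "w \<in> L"
    show "\<bar>w \<bullet> g - w \<bullet> f\<bar> \<le> t"
      using gauge_polar_ge[OF L(1) w, of "f - g"] gauge_polar_ge[OF L(1) w, of "g - f"] 1 2
      by (simp add: inner_diff_right abs_le_iff) 
  qed
qed

text \<open>Smoothness of \<open>L\<close> is strict convexity of its polar body: equal supporting hyperplanes at height one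
have equal normals.\<close>

lemma smooth_imp_unique_normal:
  fixes L :: "'a::euclidean_space set"
  assumes sm: "smooth_body L" and w: "w \<in> L"
    and f: "f \<in> polar_body L" "w \<bullet> f = 1" and g: "g \<in> polar_body L" "w \<bullet> g = 1"
  shows "f = g"
proof -
  have "w \<notin> interior L"
  proof
    assume "w \<in> interior L"
    then obtain r where r: "0 < r" "cball w r \<subseteq> L" using mem_interior_cball by blast
    have f0: "f \<noteq> 0" using f(2) by auto
    have "w + (r / norm f) *\<^sub>R f \<in> L" using r f0 by (auto simp: dist_norm)
    hence "f \<bullet> (w + (r / norm f) *\<^sub>R f) \<le> 1" using f(1) by (auto simp: polar_body_def)
    moreover have "0 < r / norm f * (f \<bullet> f)" using r f0 by simp
    ultimately show False using f(2) by (simp add: inner_add_right inner_commute)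
  qed
  hence "w \<in> frontier L" using w closure_subset by (auto simp: frontier_def)
  hence ex1: "\<exists>!H. supporting_hyperplane L w H" using sm by (auto simp: smooth_body_def)
  have sup: "supporting_hyperplane L w {v. h \<bullet> v = 1}" if "h \<in> polar_body L" "w \<bullet> h = 1" for h
    unfolding supporting_hyperplane_def
    using that by (intro exI[of _ h] exI[of _ 1]) (auto simp: polar_body_def inner_commute)
  have eq: "{v. f \<bullet> v = 1} = {v. g \<bullet> v = 1}"
    using ex1 sup[OF f] sup[OF g] by blast
  have "f \<noteq> 0" "g \<noteq> 0" using f g by auto
  have "(1 / (f \<bullet> f)) *\<^sub>R f \<in> {v. g \<bullet> v = 1}" unfolding eq[symmetric] using \<open>f \<noteq> 0\<close> by simp
  hence 1: "g \<bullet> f = f \<bullet> f" using \<open>f \<noteq> 0\<close> by simp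
  have "(1 / (g \<bullet> g)) *\<^sub>R g \<in> {v. f \<bullet> v = 1}" unfolding eq using \<open>g \<noteq> 0\<close> by simp
  hence 2: "f \<bullet> g = g \<bullet> g" using \<open>g \<noteq> 0\<close> by simp
  have "(f - g) \<bullet> (f - g) = 0"
    using 1 2 by (simp add: inner_diff_left inner_diff_right inner_commute)
  thus ?thesis by simp
qed

text \<open>Gauges of the polar body are maxima over \<open>L\<close>, so the modulus is bounded below by the minimum of a
continuous function on a compact set of quadruples. A minimum that is not positive would give two
different normals at the same point of \<open>L\<close>.\<close>

lemma modulus_pos:
  fixes L :: "'a::euclidean_space set"
  assumes L: "compact L" "0 \<in> interior L" and sm: "smooth_body L" and t: "0 < t" "t \<le> 1"
  shows "0 < modulus_of_convexity (polar_body L) t"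
proof -
  let ?P = "polar_body L"
  have L0: "0 \<in> L" using L(2) interior_subset by blast
  have cP: "compact ?P" by (rule compact_polar[OF L(2)])
  define Q where "Q = ((?P \<times> ?P) \<times> (L \<times> L)) \<inter> {q. t \<le> fst (snd q) \<bullet> (fst (fst q) - snd (fst q))}"
  define F where "F q = 1 - snd (snd q) \<bullet> (1/2) *\<^sub>R (fst (fst q) + snd (fst q))" for q :: "('a \<times> 'a) \<times> ('a \<times> 'a)"
  have cQ: "compact Q" unfolding Q_def
    by (intro compact_Int_closed compact_Times cP L closed_Collect_le continuous_intros)
  have val: "\<exists>q\<in>Q. 1 - gauge_fun ?P ((1/2) *\<^sub>R (f + g)) = F q"
    if fg: "f \<in> ?P" "g \<in> ?P" and tg: "t \<le> gauge_fun ?P (f - g)" for f g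
  proof -
    obtain z where z: "z \<in> L" "z \<bullet> (f - g) = gauge_fun ?P (f - g)" using gauge_polar_attained[OF L(1) L0] .
    obtain w where w: "w \<in> L" "w \<bullet> (1/2) *\<^sub>R (f + g) = gauge_fun ?P ((1/2) *\<^sub>R (f + g))"
      using gauge_polar_attained[OF L(1) L0] .
    show ?thesis
      using fg z w tg by (intro bexI[of _ "((f, g), (z, w))"]) (simp_all add: F_def Q_def)
  qed
  show ?thesis
  proof (cases "Q = {}")
    case True
    hence "1 \<le> modulus_of_convexity ?P t" using val by (intro modulus_greatest[OF L t(2)]) blast
    thus ?thesis by simp
  next
    case False
    have "continuous_on Q F" unfolding F_def by (intro continuous_intros)
    then obtain q where q: "q \<in> Q" "\<And>p. p \<in> Q \<Longrightarrow> F q \<le> F p"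
      using continuous_attains_inf[OF cQ False] by blast
    have "F q \<le> modulus_of_convexity ?P t"
    proof (rule modulus_greatest[OF L t(2)])
      fix f g assume "f \<in> ?P" "g \<in> ?P" "t \<le> gauge_fun ?P (f - g)"
      from val[OF this] obtain p where "p \<in> Q" "1 - gauge_fun ?P ((1/2) *\<^sub>R (f + g)) = F p" by blast
      thus "F q \<le> 1 - gauge_fun ?P ((1/2) *\<^sub>R (f + g))" using q(2)[of p] by simp
    qed
    moreover have "0 < F q"
    proof (rule ccontr)
      assume neg: "\<not> 0 < F q"
      define f g z w where "f = fst (fst q)" and "g = snd (fst q)" and "z = fst (snd q)" and "w = snd (snd q)"
      have m: "f \<in> ?P" "g \<in> ?P" "w \<in> L" "t \<le> z \<bullet> (f - g)"
        using q(1) by (auto simp: Q_def f_def g_def z_def w_def)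
      have "1 \<le> w \<bullet> (1/2) *\<^sub>R (f + g)" using neg by (simp add: F_def f_def g_def w_def)
      hence "2 \<le> w \<bullet> f + w \<bullet> g" by (simp add: inner_add_right)
      moreover have "w \<bullet> f \<le> 1" "w \<bullet> g \<le> 1" using m by (auto simp: polar_body_def inner_commute)
      ultimately have "w \<bullet> f = 1" "w \<bullet> g = 1" by linarith+
      hence "f = g" using smooth_imp_unique_normal[OF sm m(3) m(1) _ m(2)] by blast
      thus False using m(4) t by simp
    qed
    ultimately show ?thesis by linarith
  qed
qed

text \<open>The abstract estimate with \<open>\<eta> = \<delta>(t)\<close>. The factor \<open>1 / (1 - \<epsilon>) \<le> 5 / 4\<close> is absorbed by passing from
\<open>64\<close> to \<open>80\<close> in the smallness condition and from \<open>6\<close> to \<open>8\<close> in the conclusion.\<close>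

lemma stability_via_modulus:
  fixes K L S :: "(real^'n) set" and \<epsilon> t n :: real
  defines "n \<equiv> real CARD('n)"
  assumes n2: "2 \<le> n" and L: "convex_body L" "0 \<in> interior L" and Ln: "L \<subseteq> (*\<^sub>R) (- n) ` L"
    and sm: "smooth_body L"
    and K: "convex_body K" and far: "(1 - \<epsilon>) * n \<le> grunbaum_dist K L" and S: "regular_simplex S"
    and t: "0 < t" "t \<le> 1 / (20 * n\<^sup>2)"
    and \<epsilon>: "0 \<le> \<epsilon>" "\<epsilon> \<le> modulus_of_convexity (polar_body L) t / (80 * n ^ 4)"
  shows "banach_mazur_dist K S \<le> 1 + 8 * n ^ 3 * (\<epsilon> / modulus_of_convexity (polar_body L) t)"
proof -
  define d where "d = modulus_of_convexity (polar_body L) t"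
  have n0: "0 < n" using n2 by simp
  have cL: "compact L" "0 \<in> L" using L interior_subset by (auto simp: convex_body_def)
  have "1 \<le> n\<^sup>2" using n2 by (intro one_le_power) simp
  hence "1 / (20 * n\<^sup>2) \<le> 1 / 1" by (intro frac_le) linarith+
  hence t1: "t \<le> 1" using t by linarith
  have d: "0 < d" "d \<le> 1"
    unfolding d_def using modulus_pos[OF cL(1) L(2) sm t(1) t1] modulus_le_1[OF cL(1) L(2) t1] by auto
  have n4: "16 \<le> n ^ 4" using power_mono[OF n2, of 4] by simp
  have ed: "\<epsilon> / d \<le> 1 / (80 * n ^ 4)" using \<epsilon>(2) d n0 by (simp add: d_def field_simps)
  have "\<epsilon> \<le> d / (80 * n ^ 4)" using \<epsilon>(2) by (simp add: d_def)
  also have "\<dots> \<le> 1 / (80 * 16)" using d n4 n0 by (intro frac_le) auto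
  finally have e5: "\<epsilon> \<le> 1 / 5" by simp
  have quot: "\<epsilon> / (1 - \<epsilon>) \<le> (5/4) * \<epsilon>"
  proof -
    have "\<epsilon> / (1 - \<epsilon>) \<le> \<epsilon> / (4/5)" using e5 \<epsilon>(1) by (intro divide_left_mono) auto
    thus ?thesis by simp
  qed
  have q0: "0 \<le> \<epsilon> / (1 - \<epsilon>)" using e5 \<epsilon>(1) by simp
  have shrink: "q \<le> q / d" if "0 \<le> q" for q
    by (simp add: pos_le_divide_eq[OF d(1)] mult_left_le[OF d(2) that])
  have bound: "\<epsilon> / (1 - \<epsilon>) / d \<le> (5/4) * (\<epsilon> / d)" 
    using divide_right_mono[OF quot, of d] d by simp
  have "banach_mazur_dist K S \<le> 1 + 6 * n ^ 3 * (\<epsilon> / (1 - \<epsilon>) / d)"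
    unfolding n_def
  proof (rule stability_of_simplices[OF n2[unfolded n_def] L Ln[unfolded n_def] K far[unfolded n_def] S \<epsilon>(1)])
    show "\<epsilon> < 1" using e5 by simp
    show "near L t g f" if "f \<in> polar_body L" "g \<in> polar_body L" "z \<in> L" "z \<bullet> f = 1" "1 - d < z \<bullet> g" for f g z
      using that d(1) unfolding d_def by (intro modulus_closeness[OF cL])
    show "0 < d" "0 \<le> t" "t \<le> 1 / (20 * (real CARD('n))\<^sup>2)" using d t by (auto simp: n_def)
    show "\<epsilon> / (1 - \<epsilon>) \<le> \<epsilon> / (1 - \<epsilon>) / d" by (rule shrink[OF q0])
    show "\<epsilon> / (1 - \<epsilon>) \<le> \<epsilon> / (1 - \<epsilon>) / d * d" using d by simp
    have "(5/4) * (\<epsilon> / d) \<le> (5/4) * (1 / (80 * n ^ 4))" using ed by (intro mult_left_mono) auto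
    also have "\<dots> = 1 / (64 * n ^ 4)" by simp
    finally show "\<epsilon> / (1 - \<epsilon>) / d \<le> 1 / (64 * real CARD('n) ^ 4)" using bound by (simp add: n_def)
  qed
  also have "\<dots> \<le> 1 + 6 * n ^ 3 * ((5/4) * (\<epsilon> / d))"
    using bound n0 by (intro add_left_mono mult_left_mono) auto
  also have "\<dots> = 1 + 15/2 * (n ^ 3 * (\<epsilon> / d))" by simp
  also have "\<dots> \<le> 1 + 8 * (n ^ 3 * (\<epsilon> / d))"
    using \<epsilon>(1) d n0 by (intro add_left_mono mult_right_mono) auto
  finally show ?thesis by (simp add: d_def mult.assoc)
qed

text \<open>Both smooth cases of the theorem have this form, with different \<open>a\<close> and \<open>b\<close>. The value
\<open>r = 1 / (20 n\<^sup>3)\<close> is always admissible, and the estimate is applied once, with the modulus at the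
corresponding argument. Since the modulus is monotone, every admissible \<open>r\<close> then bounds the error,
and so does the infimum.\<close>

lemma infimal_radius_bound:
  fixes L :: "(real^'n) set" and \<epsilon> a b n :: real and R :: "real set"
  defines "n \<equiv> real CARD('n)" and "R \<equiv> {r. 0 \<le> r \<and> r / a \<le> 1 \<and> b * \<epsilon> \<le> r * modulus_of_convexity (polar_body L) (r / a)}"
  assumes n2: "2 \<le> n" and L: "convex_body L" "0 \<in> interior L" and Ln: "L \<subseteq> (*\<^sub>R) (- n) ` L"
    and sm: "smooth_body L" and a: "1 \<le> a" and b: "4 * n \<le> b" and \<epsilon>: "0 \<le> \<epsilon>" 
    and eps0: "b * \<epsilon> \<le> 1 / (20 * n ^ 3) * modulus_of_convexity (polar_body L) (1 / (20 * n ^ 3) / a)"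
  shows "R \<noteq> {} \<and> 0 \<le> Inf R \<and> Inf R < 1 \<and>
    (\<forall>K S. convex_body K \<and> (1 - \<epsilon>) * n \<le> grunbaum_dist K L \<and> regular_simplex S \<longrightarrow>
        banach_mazur_dist K S \<le> 1 + 40 * n ^ 3 * Inf R)"
proof -
  define \<delta> where "\<delta> = modulus_of_convexity (polar_body L)"
  define r0 where "r0 = 1 / (20 * n ^ 3)"
  have n0: "0 < n" using n2 by simp
  have n3: "8 \<le> n ^ 3" using power_mono[OF n2, of 3] by simp
  have r0: "0 < r0" "r0 < 1" using n3 n0 by (auto simp: r0_def field_simps)
  have cL: "compact L" using L by (simp add: convex_body_def)
  have ra: "r0 / a \<le> r0" using a r0 by (simp add: field_simps)
  have t: "0 < r0 / a" "r0 / a \<le> 1" using ra r0 a by auto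
  have t20: "r0 / a \<le> 1 / (20 * n\<^sup>2)"
  proof -
    have "r0 \<le> 1 / (20 * n\<^sup>2)"
      unfolding r0_def using n2 by (intro divide_left_mono mult_left_mono power_increasing) auto
    thus ?thesis using ra by linarith
  qed
  have d0: "0 < \<delta> (r0 / a)" unfolding \<delta>_def by (rule modulus_pos[OF cL L(2) sm t])
  have r0R: "r0 \<in> R" using r0 t eps0 by (simp add: R_def r0_def)
  have Rge: "0 \<le> r" if "r \<in> R" for r using that by (simp add: R_def)
  have bdd: "bdd_below R" using Rge by (rule bdd_belowI)
  have ne: "R \<noteq> {}" using r0R by blast
  have b0: "0 < b" using b n0 by linarith
  have frac: "\<epsilon> / \<delta> (r0 / a) \<le> r / (4 * n)" if r: "r \<in> R" for r
  proof -
    have "b * \<epsilon> \<le> r * \<delta> (r0 / a)"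
    proof (cases "r \<le> r0")
      case True
      have "\<delta> (r / a) \<le> \<delta> (r0 / a)"
        unfolding \<delta>_def using True a t by (intro modulus_mono[OF cL L(2)] divide_right_mono) auto
      hence "r * \<delta> (r / a) \<le> r * \<delta> (r0 / a)" using Rge[OF r] by (rule mult_left_mono)
      thus ?thesis using r by (simp add: R_def \<delta>_def)
    next
      case False
      have "b * \<epsilon> \<le> r0 * \<delta> (r0 / a)" using eps0 by (simp add: r0_def \<delta>_def)
      also have "\<dots> \<le> r * \<delta> (r0 / a)" using False d0 by (intro mult_right_mono) auto
      finally show ?thesis .
    qed
    moreover have "4 * n * \<epsilon> \<le> b * \<epsilon>" using b \<epsilon> by (rule mult_right_mono)
    ultimately show ?thesis using d0 n0 by (simp add: field_simps)
  qed
  have main: "banach_mazur_dist K S \<le> 1 + 40 * n ^ 3 * Inf R"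
    if K: "convex_body K" "(1 - \<epsilon>) * n \<le> grunbaum_dist K L" "regular_simplex S" for K S
  proof -
    have "\<epsilon> \<le> \<delta> (r0 / a) / (80 * n ^ 4)"
    proof -
      have "\<epsilon> / \<delta> (r0 / a) \<le> r0 / (4 * n)" by (rule frac[OF r0R])
      also have "\<dots> = 1 / (80 * n ^ 4)" by (simp add: r0_def power3_eq_cube power4_eq_xxxx)
      finally show ?thesis using d0 n0 by (simp add: field_simps)
    qed
    from stability_via_modulus[OF n2[unfolded n_def] L Ln[unfolded n_def] sm K(1) K(2)[unfolded n_def] K(3) t(1) 
        t20[unfolded n_def] \<epsilon> this[unfolded \<delta>_def n_def]]
    have bm: "banach_mazur_dist K S \<le> 1 + 8 * n ^ 3 * (\<epsilon> / \<delta> (r0 / a))" by (simp add: \<delta>_def n_def)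
    have "(banach_mazur_dist K S - 1) / (40 * n ^ 3) \<le> Inf R"
    proof (rule cInf_greatest[OF ne])
      fix r assume r: "r \<in> R"
      have "8 * n ^ 3 * (\<epsilon> / \<delta> (r0 / a)) \<le> 8 * n ^ 3 * (r / (4 * n))"
        using frac[OF r] n0 by (intro mult_left_mono) auto
      also have "\<dots> \<le> 8 * n ^ 3 * (r / 1)" 
        using n2 Rge[OF r] by (intro mult_left_mono divide_left_mono) auto
      also have "\<dots> \<le> 40 * n ^ 3 * r" using n0 Rge[OF r] by (simp add: mult_nonneg_nonneg)
      finally show "(banach_mazur_dist K S - 1) / (40 * n ^ 3) \<le> r"
        using bm n0 by (simp add: field_simps)
    qed
    thus ?thesis using n0 by (simp add: field_simps)
  qed
  show ?thesis
    using ne main cInf_greatest[OF ne Rge] cInf_lower[OF r0R bdd] r0(2) by auto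
qed

section \<open>Ellipsoids\<close>

text \<open>Pulled back by the adjoint, the polar body of \<open>T ` cball 0 1\<close> is contained in the unit ball, so
\<open>|u - v|\<^sup>2 \<le> 2 - 2 \<langle>u, v\<rangle>\<close> for pulled back functionals. The point of contact \<open>z\<close> pulls back to the
pulled back \<open>f\<close> itself.\<close>

lemma centred_ellipsoid_closeness:
  fixes T :: "'a::euclidean_space \<Rightarrow> 'a"
  assumes T: "linear T" and fg: "f \<in> polar_body (T ` cball 0 1)" "g \<in> polar_body (T ` cball 0 1)"
    and z: "z \<in> T ` cball 0 1" "z \<bullet> f = 1" and t: "0 \<le> t" and close: "1 - t\<^sup>2 / 2 < z \<bullet> g"
  shows "near (T ` cball 0 1) t g f"
proof -
  define A where "A = adjoint T"
  have A: "T x \<bullet> h = x \<bullet> A h" for x h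
    unfolding A_def by (rule adjoint_works[OF T, symmetric])
  have norm1: "norm (A h) \<le> 1" if h: "h \<in> polar_body (T ` cball 0 1)" for h
  proof (cases "A h = 0")
    case False
    have "T ((1 / norm (A h)) *\<^sub>R A h) \<bullet> h \<le> 1"
      using h False by (auto simp: polar_body_def inner_commute)
    thus ?thesis unfolding A using False by (simp add: power2_norm_eq_inner[symmetric] power2_eq_square)
  qed simp
  obtain x where x: "norm x \<le> 1" "z = T x" using z(1) by auto
  have sq: "(norm (u - v))\<^sup>2 \<le> 2 - 2 * (u \<bullet> v)" if "norm u \<le> 1" "norm v \<le> 1" for u v :: 'a
  proof -
    have "(norm u)\<^sup>2 \<le> 1" "(norm v)\<^sup>2 \<le> 1" using that by (auto simp: power_le_one)
    thus ?thesis by (simp add: power2_norm_eq_inner inner_diff_left inner_diff_right inner_commute)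
  qed
  have "(norm (x - A f))\<^sup>2 \<le> 0" using sq[OF x(1) norm1[OF fg(1)]] z(2) by (simp add: x(2) A)
  hence xf: "x = A f" by simp
  have "(norm (A g - A f))\<^sup>2 \<le> 2 - 2 * (A g \<bullet> A f)" by (rule sq[OF norm1[OF fg(2)] norm1[OF fg(1)]])
  moreover have "A g \<bullet> A f = z \<bullet> g" 
  proof -
    have "z \<bullet> g = x \<bullet> A g" by (simp only: x(2) A)
    thus ?thesis unfolding xf by (simp only: inner_commute)
  qed
  ultimately have "(norm (A g - A f))\<^sup>2 \<le> t\<^sup>2" using close by simp
  hence le: "norm (A g - A f) \<le> t" using t by (rule power2_le_imp_le)
  show ?thesis unfolding near_def
  proof
    fix w assume "w \<in> T ` cball 0 1"
    then obtain y where y: "norm y \<le> 1" "w = T y" by auto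
    have "\<bar>w \<bullet> g - w \<bullet> f\<bar> = \<bar>y \<bullet> (A g - A f)\<bar>" by (simp add: y A inner_diff_right)
    also have "\<dots> \<le> norm y * norm (A g - A f)" by (rule Cauchy_Schwarz_ineq2)
    also have "\<dots> \<le> 1 * t" using y le by (intro mult_mono) auto
    finally show "\<bar>w \<bullet> g - w \<bullet> f\<bar> \<le> t" by simp
  qed
qed

text \<open>The abstract estimate with \<open>t = 1 / (20 n\<^sup>2)\<close>, the largest distance that it permits, and
\<open>\<eta> = t\<^sup>2 / 2\<close>, for which \<open>\<beta> = 1000 n\<^sup>4 \<epsilon>\<close> suffices.\<close>

lemma ellipsoid_bound:
  fixes K L S :: "(real^'n) set" and \<epsilon> n :: real
  defines "n \<equiv> real CARD('n)"
  assumes n2: "2 \<le> n" and L: "ellipsoid L" and K: "convex_body K" 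
    and far: "(1 - \<epsilon>) * n \<le> grunbaum_dist K L" and S: "regular_simplex S"
    and \<epsilon>: "0 \<le> \<epsilon>" "\<epsilon> \<le> 1 / (128000 * n ^ 9)"
  shows "banach_mazur_dist K S \<le> 1 + 6000 * n ^ 7 * \<epsilon>"
proof -
  obtain T :: "real^'n \<Rightarrow> real^'n" and c where T: "linear T" "bij T" and LT: "L = (\<lambda>x. T x + c) ` cball 0 1"
    using L unfolding ellipsoid_def by blast
  define E where "E = T ` cball (0 :: real^'n) 1"
  have n0: "0 < n" using n2 by simp
  have "L = (\<lambda>x. x + c) ` E" by (simp add: LT E_def image_image)
  hence far': "(1 - \<epsilon>) * n \<le> grunbaum_dist K E" using far by (simp add: grunbaum_dist_translate)
  have int: "interior E = T ` ball 0 1"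
    unfolding E_def using T by (simp add: interior_bijective_linear_image)
  have E0: "0 \<in> interior E" unfolding int using linear_0[OF T(1)] by (force intro: image_eqI[of _ _ 0])
  have "compact E"
    unfolding E_def using T(1) by (intro compact_continuous_image compact_cball) (simp add: linear_continuous_on linear_conv_bounded_linear)
  moreover have "convex E" unfolding E_def by (intro convex_linear_image T convex_cball)
  ultimately have E: "convex_body E" using E0 by (auto simp: convex_body_def)
  have En: "E \<subseteq> (*\<^sub>R) (- n) ` E"
  proof
    fix y assume "y \<in> E"
    then obtain x where x: "norm x \<le> 1" "y = T x" by (auto simp: E_def)
    have "norm ((- 1 / n) *\<^sub>R x) \<le> 1" using x(1) n2 by (simp add: field_simps)
    hence "T ((- 1 / n) *\<^sub>R x) \<in> E" by (simp add: E_def)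
    moreover have "y = (- n) *\<^sub>R T ((- 1 / n) *\<^sub>R x)" using n0 by (simp add: x linear_scale[OF T(1)] linear_neg[OF T(1)])
    ultimately show "y \<in> (*\<^sub>R) (- n) ` E" by blast
  qed
  have n9: "n ^ 5 \<le> n ^ 9" "1 \<le> n ^ 4" "1 \<le> n ^ 9" using n2 by (auto intro: power_increasing one_le_power)
  have "\<epsilon> \<le> 1 / (128000 * 1)" by (rule order_trans[OF \<epsilon>(2)]) (use n9 n0 in \<open>intro divide_left_mono, auto\<close>)
  hence e5: "\<epsilon> \<le> 1 / 5" by simp
  have quot: "\<epsilon> / (1 - \<epsilon>) \<le> (5/4) * \<epsilon>"
  proof -
    have "\<epsilon> / (1 - \<epsilon>) \<le> \<epsilon> / (4/5)" using e5 \<epsilon>(1) by (intro divide_left_mono) auto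
    thus ?thesis by simp
  qed
  have q0: "0 \<le> \<epsilon> / (1 - \<epsilon>)" using e5 \<epsilon>(1) by simp
  define t where "t = 1 / (20 * n\<^sup>2)"
  have t: "0 < t" using n0 by (simp add: t_def)
  have t2: "t\<^sup>2 / 2 = 1 / (800 * n ^ 4)" by (simp add: t_def power_divide power_mult_distrib power_mult[symmetric])
  have "banach_mazur_dist K S \<le> 1 + 6 * n ^ 3 * (1000 * n ^ 4 * \<epsilon>)"
    unfolding n_def
  proof (rule stability_of_simplices[OF n2[unfolded n_def] E E0 En[unfolded n_def] K far'[unfolded n_def] S \<epsilon>(1)])
    show "\<epsilon> < 1" using e5 by simp
    show "near E t g f" if "f \<in> polar_body E" "g \<in> polar_body E" "z \<in> E" "z \<bullet> f = 1" "1 - t\<^sup>2 / 2 < z \<bullet> g" for f g z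
      using that t unfolding E_def by (intro centred_ellipsoid_closeness[OF T(1)]) auto
    show "0 < t\<^sup>2 / 2" "0 \<le> t" "t \<le> 1 / (20 * (real CARD('n))\<^sup>2)" using t by (auto simp: t_def n_def)
    have "(5/4) * \<epsilon> \<le> (1000 * n ^ 4) * \<epsilon>" using n9 \<epsilon>(1) by (intro mult_right_mono) auto
    thus "\<epsilon> / (1 - \<epsilon>) \<le> 1000 * real CARD('n) ^ 4 * \<epsilon>" using quot unfolding n_def by linarith
    have "1000 * n ^ 4 * \<epsilon> * (t\<^sup>2 / 2) = (5/4) * \<epsilon>" unfolding t2 using n0 by simp
    thus "\<epsilon> / (1 - \<epsilon>) \<le> 1000 * real CARD('n) ^ 4 * \<epsilon> * (t\<^sup>2 / 2)" using quot unfolding n_def by linarith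
    have "1000 * n ^ 4 * \<epsilon> \<le> 1000 * n ^ 4 * (1 / (128000 * n ^ 9))" using \<epsilon>(2) n0 by (intro mult_left_mono) auto
    also have "\<dots> = 1 / (128 * n ^ 5)" using n0 by (simp add: field_simps power_add[symmetric])
    also have "\<dots> \<le> 1 / (64 * n ^ 4)"
      using n2 n0 power_increasing[of 4 5 n] by (intro divide_left_mono mult_mono) auto
    finally show "1000 * real CARD('n) ^ 4 * \<epsilon> \<le> 1 / (64 * real CARD('n) ^ 4)" by (simp add: n_def)
  qed
  also have "\<dots> = 1 + 6000 * n ^ 7 * \<epsilon>" by (simp add: power_add[symmetric])
  finally show ?thesis .
qed

section \<open>The stability theorem\<close>

theorem theorem4:
  fixes L :: "(real ^ 'n) set" and n :: real and \<delta> :: "real \<Rightarrow> real"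
  defines "n \<equiv> real CARD('n)"
    and "\<delta> \<equiv> modulus_of_convexity (polar_body L)"
  assumes "CARD('n) \<ge> 2"
    and "convex_body L"
    and "smooth_body L"
    and "0 \<in> interior L"
    and "L \<subseteq> (*\<^sub>R) (- n) ` L"
  shows
    "(let \<epsilon>0 = \<delta> (1 / (80 * n ^ 6)) / (80 * n ^ 5) in
        \<epsilon>0 > 0 \<and>
        (\<forall>\<epsilon>. 0 \<le> \<epsilon> \<and> \<epsilon> \<le> \<epsilon>0 \<longrightarrow>
          (let R = {r. 0 \<le> r \<and> r / (4 * n ^ 3) \<le> 1 \<and> r * \<delta> (r / (4 * n ^ 3)) \<ge> 4 * n ^ 2 * \<epsilon>};
               r = Inf R
           in R \<noteq> {} \<and> 0 \<le> r \<and> r < 1 \<and>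
              (\<forall>K S. convex_body K \<and> grunbaum_dist K L \<ge> (1 - \<epsilon>) * n \<and> regular_simplex S
                 \<longrightarrow> banach_mazur_dist K S \<le> 1 + 40 * n ^ 3 * r))))
     \<and>
     (centrally_symmetric L \<longrightarrow>
       (let \<epsilon>0 = \<delta> (1 / (40 * n ^ 5)) / (80 * n ^ 4) in
        \<epsilon>0 > 0 \<and>
        (\<forall>\<epsilon>. 0 \<le> \<epsilon> \<and> \<epsilon> \<le> \<epsilon>0 \<longrightarrow>
          (let R = {r. 0 \<le> r \<and> r / (2 * n ^ 2) \<le> 1 \<and> r * \<delta> (r / (2 * n ^ 2)) \<ge> 4 * n * \<epsilon>};
               r = Inf R
           in R \<noteq> {} \<and> 0 \<le> r \<and> r < 1 \<and>
              (\<forall>K S. convex_body K \<and> grunbaum_dist K L \<ge> (1 - \<epsilon>) * n \<and> regular_simplex S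
                 \<longrightarrow> banach_mazur_dist K S \<le> 1 + 40 * n ^ 3 * r)))))
     \<and>
     (ellipsoid L \<longrightarrow>
       (let \<epsilon>0 = 1 / (128000 * n ^ 9) in
        \<epsilon>0 > 0 \<and>
        (\<forall>\<epsilon>. 0 \<le> \<epsilon> \<and> \<epsilon> \<le> \<epsilon>0 \<longrightarrow>
          (let r = root 3 (16 * \<epsilon>)
           in 0 \<le> r \<and> r < 1 \<and>
              (\<forall>K S. convex_body K \<and> grunbaum_dist K L \<ge> (1 - \<epsilon>) * n \<and> regular_simplex S
                 \<longrightarrow> banach_mazur_dist K S \<le> 1 + 40 * n ^ 3 * r)))))"
proof -
  have n2: "2 \<le> n" using assms(3) by (simp add: n_def)
  hence n0: "0 < n" by simp
  have cL: "compact L" using assms(4) by (simp add: convex_body_def)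
  have pow: "1 \<le> n ^ k" for k using n2 by (intro one_le_power) simp
  have \<delta>pos: "0 < \<delta> (1 / x)" if "1 \<le> x" for x
    unfolding \<delta>_def using that by (intro modulus_pos[OF cL assms(6,5)]) auto
  note ax = n2[unfolded n_def] assms(4,6) assms(7)[unfolded n_def] assms(5)
  have general_case: "(let \<epsilon>0 = \<delta> (1 / (80 * n ^ 6)) / (80 * n ^ 5) in
        \<epsilon>0 > 0 \<and>
        (\<forall>\<epsilon>. 0 \<le> \<epsilon> \<and> \<epsilon> \<le> \<epsilon>0 \<longrightarrow>
          (let R = {r. 0 \<le> r \<and> r / (4 * n ^ 3) \<le> 1 \<and> r * \<delta> (r / (4 * n ^ 3)) \<ge> 4 * n ^ 2 * \<epsilon>};
               r = Inf R
           in R \<noteq> {} \<and> 0 \<le> r \<and> r < 1 \<and>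
              (\<forall>K S. convex_body K \<and> grunbaum_dist K L \<ge> (1 - \<epsilon>) * n \<and> regular_simplex S
                 \<longrightarrow> banach_mazur_dist K S \<le> 1 + 40 * n ^ 3 * r))))"
    unfolding Let_def
  proof (intro conjI[OF _ allI] impI)
    show "0 < \<delta> (1 / (80 * n ^ 6)) / (80 * n ^ 5)" using \<delta>pos[of "80 * n ^ 6"] pow[of 6] n0 by simp
    fix \<epsilon> assume \<epsilon>: "0 \<le> \<epsilon> \<and> \<epsilon> \<le> \<delta> (1 / (80 * n ^ 6)) / (80 * n ^ 5)"
    have a: "1 \<le> 4 * n ^ 3" using pow[of 3] by simp
    have b: "4 * n \<le> 4 * n ^ 2" using n2 by (simp add: power2_eq_square)
    have eq: "1 / (20 * n ^ 3) / (4 * n ^ 3) = 1 / (80 * n ^ 6)" by (simp add: power_add[symmetric])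
    have "4 * n ^ 2 * \<epsilon> \<le> 4 * n ^ 2 * (\<delta> (1 / (80 * n ^ 6)) / (80 * n ^ 5))"
      using \<epsilon> by (intro mult_left_mono) auto
    also have "\<dots> = 1 / (20 * n ^ 3) * \<delta> (1 / (80 * n ^ 6))"
      using n0 by (simp add: field_simps power_add[symmetric])
    finally have e: "4 * n ^ 2 * \<epsilon> \<le> 1 / (20 * n ^ 3) * \<delta> (1 / (20 * n ^ 3) / (4 * n ^ 3))" unfolding eq .
    from infimal_radius_bound[OF ax a[unfolded n_def] b[unfolded n_def] conjunct1[OF \<epsilon>] e[unfolded \<delta>_def n_def]]
    show "{r. 0 \<le> r \<and> r / (4 * n ^ 3) \<le> 1 \<and> r * \<delta> (r / (4 * n ^ 3)) \<ge> 4 * n ^ 2 * \<epsilon>} \<noteq> {} \<and>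
       0 \<le> Inf {r. 0 \<le> r \<and> r / (4 * n ^ 3) \<le> 1 \<and> r * \<delta> (r / (4 * n ^ 3)) \<ge> 4 * n ^ 2 * \<epsilon>} \<and>
       Inf {r. 0 \<le> r \<and> r / (4 * n ^ 3) \<le> 1 \<and> r * \<delta> (r / (4 * n ^ 3)) \<ge> 4 * n ^ 2 * \<epsilon>} < 1 \<and>
       (\<forall>K S. convex_body K \<and> grunbaum_dist K L \<ge> (1 - \<epsilon>) * n \<and> regular_simplex S
                 \<longrightarrow> banach_mazur_dist K S \<le> 1 + 40 * n ^ 3 * 
         Inf {r. 0 \<le> r \<and> r / (4 * n ^ 3) \<le> 1 \<and> r * \<delta> (r / (4 * n ^ 3)) \<ge> 4 * n ^ 2 * \<epsilon>})"
      unfolding n_def \<delta>_def .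
  qed
  have symmetric_case: "(let \<epsilon>0 = \<delta> (1 / (40 * n ^ 5)) / (80 * n ^ 4) in
        \<epsilon>0 > 0 \<and>
        (\<forall>\<epsilon>. 0 \<le> \<epsilon> \<and> \<epsilon> \<le> \<epsilon>0 \<longrightarrow>
          (let R = {r. 0 \<le> r \<and> r / (2 * n ^ 2) \<le> 1 \<and> r * \<delta> (r / (2 * n ^ 2)) \<ge> 4 * n * \<epsilon>};
               r = Inf R
           in R \<noteq> {} \<and> 0 \<le> r \<and> r < 1 \<and>
              (\<forall>K S. convex_body K \<and> grunbaum_dist K L \<ge> (1 - \<epsilon>) * n \<and> regular_simplex S
                 \<longrightarrow> banach_mazur_dist K S \<le> 1 + 40 * n ^ 3 * r))))"
    unfolding Let_def
  proof (intro conjI[OF _ allI] impI)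
    show "0 < \<delta> (1 / (40 * n ^ 5)) / (80 * n ^ 4)" using \<delta>pos[of "40 * n ^ 5"] pow[of 5] n0 by simp
    fix \<epsilon> assume \<epsilon>: "0 \<le> \<epsilon> \<and> \<epsilon> \<le> \<delta> (1 / (40 * n ^ 5)) / (80 * n ^ 4)"
    have a: "1 \<le> 2 * n ^ 2" using pow[of 2] by simp
    have eq: "1 / (20 * n ^ 3) / (2 * n ^ 2) = 1 / (40 * n ^ 5)" by (simp add: power_add[symmetric])
    have "4 * n * \<epsilon> \<le> 4 * n * (\<delta> (1 / (40 * n ^ 5)) / (80 * n ^ 4))"
      using \<epsilon> n0 by (intro mult_left_mono) auto
    also have "\<dots> = 1 / (20 * n ^ 3) * \<delta> (1 / (40 * n ^ 5))"
      using n0 by (simp add: field_simps power4_eq_xxxx power3_eq_cube)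
    finally have e: "4 * n * \<epsilon> \<le> 1 / (20 * n ^ 3) * \<delta> (1 / (20 * n ^ 3) / (2 * n ^ 2))" unfolding eq .
    from infimal_radius_bound[OF ax a[unfolded n_def] order_refl conjunct1[OF \<epsilon>] e[unfolded \<delta>_def n_def]]
    show "{r. 0 \<le> r \<and> r / (2 * n ^ 2) \<le> 1 \<and> r * \<delta> (r / (2 * n ^ 2)) \<ge> 4 * n * \<epsilon>} \<noteq> {} \<and>
       0 \<le> Inf {r. 0 \<le> r \<and> r / (2 * n ^ 2) \<le> 1 \<and> r * \<delta> (r / (2 * n ^ 2)) \<ge> 4 * n * \<epsilon>} \<and>
       Inf {r. 0 \<le> r \<and> r / (2 * n ^ 2) \<le> 1 \<and> r * \<delta> (r / (2 * n ^ 2)) \<ge> 4 * n * \<epsilon>} < 1 \<and>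
       (\<forall>K S. convex_body K \<and> grunbaum_dist K L \<ge> (1 - \<epsilon>) * n \<and> regular_simplex S
                 \<longrightarrow> banach_mazur_dist K S \<le> 1 + 40 * n ^ 3 * 
         Inf {r. 0 \<le> r \<and> r / (2 * n ^ 2) \<le> 1 \<and> r * \<delta> (r / (2 * n ^ 2)) \<ge> 4 * n * \<epsilon>})"
      unfolding n_def \<delta>_def .
  qed
  have ellipsoid_case: "let \<epsilon>0 = 1 / (128000 * n ^ 9) in
        \<epsilon>0 > 0 \<and>
        (\<forall>\<epsilon>. 0 \<le> \<epsilon> \<and> \<epsilon> \<le> \<epsilon>0 \<longrightarrow>
          (let r = root 3 (16 * \<epsilon>)
           in 0 \<le> r \<and> r < 1 \<and>
              (\<forall>K S. convex_body K \<and> grunbaum_dist K L \<ge> (1 - \<epsilon>) * n \<and> regular_simplex S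
                 \<longrightarrow> banach_mazur_dist K S \<le> 1 + 40 * n ^ 3 * r)))" if ell: "ellipsoid L"
    unfolding Let_def
  proof (intro conjI[OF _ allI] impI)
    show "0 < 1 / (128000 * n ^ 9)" using n0 by simp
    fix \<epsilon> assume \<epsilon>: "0 \<le> \<epsilon> \<and> \<epsilon> \<le> 1 / (128000 * n ^ 9)"
    \<comment> \<open>\<open>r \<le> 1 / (20 n\<^sup>3)\<close> turns the linear bound \<open>6000 n\<^sup>7 \<epsilon> = 375 n\<^sup>7 r\<^sup>3\<close> into a multiple of \<open>n\<^sup>3 r\<close>\<close>
    define r where "r = root 3 (16 * \<epsilon>)"
    have r0: "0 \<le> r" using \<epsilon> by (simp add: r_def)
    have r3: "r ^ 3 = 16 * \<epsilon>" using \<epsilon> by (simp add: r_def)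
    have "r ^ 3 \<le> 16 * (1 / (128000 * n ^ 9))" unfolding r3 using \<epsilon> by (intro mult_left_mono) auto
    also have "\<dots> = (1 / (20 * n ^ 3)) ^ 3" by (simp add: power_divide power_mult_distrib power_mult[symmetric])
    finally have r_le: "r \<le> 1 / (20 * n ^ 3)"
      using n0 by (simp add: power_mono_iff[OF r0])
    also have "\<dots> \<le> 1 / 20" using pow[of 3] n0 by (simp add: field_simps)
    finally have r1: "r < 1" by simp
    have "6000 * n ^ 7 * \<epsilon> = 375 * n ^ 3 * r * (n ^ 4 * r\<^sup>2)"
    proof -
      have "6000 * n ^ 7 * \<epsilon> = 375 * n ^ 7 * r ^ 3" unfolding r3 by simp
      also have "\<dots> = 375 * (n ^ 3 * n ^ 4) * (r * r\<^sup>2)" by (simp add: power_add[symmetric] power_Suc[symmetric] del: power_Suc)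
      finally show ?thesis by (simp only: mult_ac)
    qed
    also have "\<dots> \<le> 375 * n ^ 3 * r * (1 / 400)"
    proof (rule mult_left_mono)
      have "n ^ 4 * r\<^sup>2 \<le> n ^ 4 * (1 / (20 * n ^ 3))\<^sup>2" using r_le r0 by (intro mult_left_mono power_mono) auto
      also have "\<dots> = 1 / (400 * n\<^sup>2)" using n0 
        by (simp add: power_divide power_mult_distrib power_mult[symmetric] field_simps power_add[symmetric])
      also have "\<dots> \<le> 1 / 400" using pow[of 2] n0 by (simp add: field_simps)
      finally show "n ^ 4 * r\<^sup>2 \<le> 1 / 400" .
      show "0 \<le> 375 * n ^ 3 * r" using r0 n0 by simp
    qed
    also have "\<dots> \<le> 40 * n ^ 3 * r" using r0 n0 by (simp add: mult_nonneg_nonneg)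
    finally have le: "6000 * n ^ 7 * \<epsilon> \<le> 40 * n ^ 3 * r" .
    have "banach_mazur_dist K S \<le> 1 + 40 * n ^ 3 * r"
      if "convex_body K" "grunbaum_dist K L \<ge> (1 - \<epsilon>) * n" "regular_simplex S" for K S :: "(real^'n) set"
      using ellipsoid_bound[OF n2[unfolded n_def] ell that(1) that(2)[unfolded n_def] that(3), folded n_def] \<epsilon> le
      by linarith
    thus "0 \<le> root 3 (16 * \<epsilon>) \<and> root 3 (16 * \<epsilon>) < 1 \<and>
      (\<forall>K S. convex_body K \<and> grunbaum_dist K L \<ge> (1 - \<epsilon>) * n \<and> regular_simplex S
                 \<longrightarrow> banach_mazur_dist K S \<le> 1 + 40 * n ^ 3 * root 3 (16 * \<epsilon>))"
      using r0 r1 by (auto simp: r_def)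
  qed
  show ?thesis using general_case symmetric_case ellipsoid_case by blast
qed

end
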